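(* Let $X$ be a locally connected, simply connected, homogeneous continuum. Then no arc separates $X$; that is, for every arc $\alpha\subset X$ the set $X\smallsetminus\alpha$ has fewer than two connected components.
   Context: A continuum is a compact connected metric space. $X$ is homogeneous if for all $x,y\in X$ there is a homeomorphism $h:X\to X$ with $h(x)=y$. $X$ is simply connected if it is path connected and every continuous map $f:S^1=\partial D^2\to X$ extends to a continuous map $\bar f:D^2\to X$, where $D^2$ is the closed 2-disc and $S^1$ its boundary circle. An arc in $X$ is (the image of) a continuous injective map $\alpha:[0,1]\to X$; an arc is identified with its image. An arc $\alpha$ separates $X$ if $X\smallsetminus\alpha$ has at least two connected components. *)

theory Defs
  imports "HOL-Analysis.Analysis"
begin

text \<open>
  Spaces are represented by subsets \<open>X\<close> of an arbitrary metric space type and carry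
  the subspace metric and topology.
\<close>

definition continuum :: "'a::metric_space set \<Rightarrow> bool"
  where "continuum X \<longleftrightarrow> compact X \<and> connected X"

definition homogeneous :: "'a::topological_space set \<Rightarrow> bool"
  where "homogeneous X \<longleftrightarrow> (\<forall>x\<in>X. \<forall>y\<in>X. \<exists>h k. homeomorphism X X h k \<and> h x = y)"

text \<open>
  This is the disc-extension form of simple connectedness, not the library's
  \<^const>\<open>simply_connected\<close>, which is phrased with free homotopies of loops. The closed
  disc and its boundary circle are taken in the complex plane.
\<close>

definition disc_simply_connected :: "'a::topological_space set \<Rightarrow> bool"
  where "disc_simply_connected X \<longleftrightarrow>
    path_connected X \<and>
    (\<forall>f. continuous_on (sphere (0::complex) 1) f \<and> f ` sphere 0 1 \<subseteq> X \<longrightarrow>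
      (\<exists>g. continuous_on (cball (0::complex) 1) g \<and> g ` cball 0 1 \<subseteq> X \<and>
           (\<forall>z\<in>sphere 0 1. g z = f z)))"

text \<open>
  At least two connected components; stated without \<^const>\<open>card\<close>, which would be 0
  if there were infinitely many.
\<close>

definition separates :: "'a::topological_space set \<Rightarrow> 'a set \<Rightarrow> bool"
  where "separates A X \<longleftrightarrow>
    (\<exists>C\<in>components (X - A). \<exists>D\<in>components (X - A). C \<noteq> D)"

end

theory Submission
  imports Defs
begin

text \<open>
  Suppose that an arc separates \<open>x\<close> from \<open>y\<close> in \<open>X\<close>. Cutting it down from both ends gives a subarc
  \<open>\<gamma>\<close> that still separates them while no proper initial or final piece of \<open>\<gamma>\<close> does
  (\<open>minimal_separating_subarc\<close>). The subarc does not shrink to a point, because some point of a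
  continuum is not a cut point (\<open>exists_non_cut_point\<close>) and hence, by homogeneity, none is. The
  contradiction comes from comparing the midpoint of \<open>\<gamma>\<close> with its endpoint \<open>p = \<gamma> 0\<close>: homogeneity
  makes \<open>p\<close> look like both.

  At the midpoint the space winds around. A path from \<open>x\<close> to \<open>y\<close> that avoids the first half of
  \<open>\<gamma>\<close>, followed by a path back that avoids the second half, is a loop that has winding number
  \<open>\<plusminus>1\<close> with respect to a suitable map \<open>\<phi>\<close> from \<open>X\<close> to the complex plane whose only zero is the
  midpoint (\<open>essential_loop_around_interior_point\<close>). A homeomorphism of \<open>X\<close> carries the map and the
  loop to the point \<open>p\<close>. That a loop winds around a point is expressed by the absence of a continuous
  logarithm.

  At the endpoint the loop can be pushed to one side. Let \<open>C\<close> be the component of \<open>x\<close> in the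
  complement of \<open>\<gamma>\<close>. The sets \<open>X - C\<close> and \<open>C \<union> \<gamma>\<close> cover \<open>X\<close> and meet in \<open>\<gamma>\<close>, and both are retracts of
  \<open>X\<close>, because an arc is an absolute retract. Without \<open>p\<close> their intersection is a half-open arc,
  over which \<open>\<phi>\<close> has a logarithm; so, by a Mayer-Vietoris argument, the loop can be replaced by a
  loop around \<open>p\<close> inside one of the two retracts, say \<open>A\<close>.

  The loop in \<open>A\<close> bounds a disc in \<open>X\<close>, by simple connectedness, and hence a disc in \<open>A\<close>. As
  the loop winds around \<open>p\<close>, that disc covers \<open>p\<close>, and it keeps covering \<open>p\<close> after any small
  perturbation. Now perturb by the inverse of a homeomorphism \<open>h\<close>: the disc then covers \<open>p\<close> only if
  \<open>h p \<in> A\<close>. But \<open>p\<close> lies in the closure of each of the two sides of \<open>\<gamma>\<close>, in particular in the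
  closure of an open set disjoint from \<open>A\<close>, and a weak form of Effros' theorem
  (\<open>approximate_homogeneity\<close>) provides an \<open>h\<close> with inverse close to the identity that moves \<open>p\<close> into
  that set (\<open>logarithm_of_loop_in_retract\<close>).

  Components of open subsets of \<open>X\<close> are joined by paths throughout; this rests on the classical
  fact that a compact locally connected metric space is locally path connected.
\<close>

section \<open>Local path connectedness of Peano spaces\<close>

text \<open>
  \<open>e\<close>-small connected sets are the steps from which paths are assembled. The relation is stronger
  than \<open>dist u v < e\<close>, and by local connectedness it holds for all \<open>v\<close> near \<open>u\<close>.
\<close>

definition close_joined :: "'a::metric_space set \<Rightarrow> real \<Rightarrow> 'a \<Rightarrow> 'a \<Rightarrow> bool"
  where "close_joined X e u v \<longleftrightarrow>
    (\<exists>C. connected C \<and> C \<subseteq> X \<and> u \<in> C \<and> v \<in> C \<and> (\<forall>a\<in>C. \<forall>b\<in>C. dist a b < e))"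

lemma close_joined_refl: "x \<in> X \<Longrightarrow> e > 0 \<Longrightarrow> close_joined X e x x"
  unfolding close_joined_def by (rule exI[of _ "{x}"]) auto

lemma close_joined_sym: "close_joined X e x y \<Longrightarrow> close_joined X e y x"
  unfolding close_joined_def by blast

lemma close_joined_nhd:
  assumes lc: "locally connected X" and x: "x \<in> X" and e: "e > 0"
  obtains U where "openin (top_of_set X) U" "x \<in> U" "\<And>y. y \<in> U \<Longrightarrow> close_joined X e x y"
proof -
  have "openin (top_of_set X) (X \<inter> ball x (e/2))" by (simp add: openin_open_Int)
  with lc x e obtain U where U: "openin (top_of_set X) U" "connected U" "x \<in> U" "U \<subseteq> X \<inter> ball x (e/2)"
    unfolding locally_connected by (meson IntI centre_in_ball half_gt_zero)
  have "dist a b < e" if "a \<in> U" "b \<in> U" for a b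
  proof -
    have "dist x a < e/2" "dist x b < e/2" using that U by auto
    then show ?thesis by (metis dist_commute dist_triangle_half_r)
  qed
  then show thesis using that[of U] U unfolding close_joined_def by blast
qed

text \<open>
  In a connected set, being linked by a finite chain of \<open>e\<close>-small steps is an equivalence relation with
  open classes. The chain is continued by its last point for ever, so that chains of different
  lengths can later be brought to a common length.
\<close>

lemma close_joined_chain:
  assumes lc: "locally connected X" and C: "connected C" "C \<subseteq> X" "u \<in> C" "v \<in> C" and e: "e > 0"
  obtains n f where "f 0 = u" "\<And>i. i \<ge> n \<Longrightarrow> f i = v" "\<And>i. f i \<in> C"
    "\<And>i. close_joined X e (f i) (f (Suc i))"
proof -
  define P where "P = (\<lambda>a b. a \<in> C \<and> b \<in> C \<and> close_joined X e a b)"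
  have "P\<^sup>*\<^sup>* u v"
  proof (rule connected_equivalence_relation[OF C(1,3,4)])
    show "P\<^sup>*\<^sup>* y x" if "P\<^sup>*\<^sup>* x y" "x \<in> C" "y \<in> C" for x y
    proof -
      have "symp P" unfolding P_def by (auto simp: symp_def close_joined_sym)
      then show ?thesis using that by (meson sympD symp_rtranclp)
    qed
    show "P\<^sup>*\<^sup>* x z" if "P\<^sup>*\<^sup>* x y" "P\<^sup>*\<^sup>* y z" for x y z using that by auto
    fix a assume a: "a \<in> C"
    obtain U where U: "openin (top_of_set X) U" "a \<in> U" "\<And>y. y \<in> U \<Longrightarrow> close_joined X e a y"
      using close_joined_nhd[OF lc _ e] a C by blast
    have "openin (top_of_set C) (C \<inter> U)"
      using U(1) C(2) by (metis inf.absorb_iff1 inf_commute openin_subtopology_Int2 subtopology_subtopology)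
    moreover have "\<forall>x\<in>C \<inter> U. P\<^sup>*\<^sup>* a x" using U a unfolding P_def by auto
    ultimately show "\<exists>T. openin (top_of_set C) T \<and> a \<in> T \<and> (\<forall>x\<in>T. P\<^sup>*\<^sup>* a x)"
      using a U by blast
  qed
  then obtain n where "(P ^^ n) u v" by (auto simp: rtranclp_power)
  then obtain f where f: "f 0 = u" "f n = v" "\<And>i. i < n \<Longrightarrow> P (f i) (f (Suc i))"
    by (auto simp: relpowp_fun_conv)
  let ?f = "\<lambda>i. f (min i n)"
  have fC: "f i \<in> C" if "i \<le> n" for i
    using that f C unfolding P_def by (metis le_neq_implies_less)
  show thesis
  proof (rule that[of ?f n])
    show "close_joined X e (f (min i n)) (f (min (Suc i) n))" for i
    proof (cases "i < n")
      case True then show ?thesis using f(3)[of i] by (simp add: P_def min_def)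
    next
      case False
      then have "min i n = n" "min (Suc i) n = n" by auto
      then show ?thesis using close_joined_refl[of v X e] C e f by auto
    qed
  qed (use f fC in auto)
qed

text \<open>
  Every step of a chain is replaced by a chain of finer steps inside the same small connected set.
  All the replacements get the same length \<open>K\<close>, so that the old chain is read off at the multiples of
  \<open>K\<close> and both chains are step functions on uniform subdivisions of the unit interval.
\<close>

lemma close_joined_refine:
  fixes f :: "nat \<Rightarrow> 'a::metric_space"
  assumes lc: "locally connected X" and e': "e' > 0"
    and f: "\<And>i. close_joined X e (f i) (f (Suc i))" "\<And>i. i \<ge> M \<Longrightarrow> f i = v"
  obtains K f' where "K > 0" "\<And>i. close_joined X e' (f' i) (f' (Suc i))" "\<And>i. i \<ge> M * K \<Longrightarrow> f' i = v"
    "\<And>i. f' (i * K) = f i" "\<And>i j. j < K \<Longrightarrow> dist (f i) (f' (i * K + j)) < e"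
proof -
  have "\<exists>n g. g 0 = f i \<and> (\<forall>j\<ge>n. g j = f (Suc i)) \<and> (\<forall>j. dist (f i) (g j) < e)
      \<and> (\<forall>j. close_joined X e' (g j) (g (Suc j)))" for i
  proof -
    obtain C where C: "connected C" "C \<subseteq> X" "f i \<in> C" "f (Suc i) \<in> C" "\<And>a b. a \<in> C \<Longrightarrow> b \<in> C \<Longrightarrow> dist a b < e"
      using f(1)[of i] unfolding close_joined_def by blast
    obtain n g where "g 0 = f i" "\<And>j. j \<ge> n \<Longrightarrow> g j = f (Suc i)" "\<And>j. g j \<in> C"
      "\<And>j. close_joined X e' (g j) (g (Suc j))"
      using close_joined_chain[OF lc C(1-4) e'] by metis
    then show ?thesis using C by (metis)
  qed
  then obtain n g where g: "\<And>i. g i 0 = f i" "\<And>i j. j \<ge> n i \<Longrightarrow> g i j = f (Suc i)"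
    "\<And>i j. dist (f i) (g i j) < e" "\<And>i j. close_joined X e' (g i j) (g i (Suc j))"
    by metis
  define K where "K = Suc (\<Sum>i<M. n i)"
  have nK: "n i < K" if "i < M" for i
    using that member_le_sum[of i "{..<M}" n] unfolding K_def by (simp add: le_imp_less_Suc)
  have vX: "v \<in> X" using f unfolding close_joined_def by (metis le_refl subsetD)
  have e: "e > 0" using f(1)[of 0] unfolding close_joined_def by force
  define f' where "f' = (\<lambda>k. if k div K < M then g (k div K) (k mod K) else v)"
  have K: "K > 0" by (simp add: K_def)
  show thesis
  proof (rule that[of K f'])
    show "f' i = v" if "i \<ge> M * K" for i
      using that K unfolding f'_def by (simp add: div_less_iff_less_mult leD)
    show *: "f' (i * K) = f i" for i
      using K g(1) f(2)[of i] unfolding f'_def by auto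
    show "dist (f i) (f' (i * K + j)) < e" if "j < K" for i j
      using that K g(3) f(2)[of i] e unfolding f'_def by auto
    show "close_joined X e' (f' k) (f' (Suc k))" for k
    proof -
      define i j where "i = k div K" and "j = k mod K"
      have k: "k = i * K + j" and j: "j < K" using K unfolding i_def j_def by auto
      show ?thesis
      proof (cases "i < M")
        case False
        then have "M \<le> k div K" unfolding i_def by simp
        moreover have "k div K \<le> Suc k div K" by (rule div_le_mono) simp
        ultimately have "M \<le> k div K" "M \<le> Suc k div K" by linarith+
        then have "f' k = v" "f' (Suc k) = v" unfolding f'_def by simp_all
        then show ?thesis using close_joined_refl[OF vX e'] by simp
      next
        case True
        have fk: "f' k = g i j" using True unfolding f'_def i_def j_def by simp
        have "f' (Suc k) = g i (Suc j)"
        proof (cases "Suc j < K")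
          case True
          then have "Suc k div K = i" "Suc k mod K = Suc j"
            using div_mult_self3[of K i "Suc j"] mod_mult_self3[of i K "Suc j"] K k by simp_all
          then show ?thesis using \<open>i < M\<close> unfolding f'_def by simp
        next
          case False
          then have sj: "Suc j = K" using j by simp
          then have "Suc k = Suc i * K" using k by simp
          then have "f' (Suc k) = f (Suc i)" using *[of "Suc i"] by simp
          also have "\<dots> = g i (Suc j)" using g(2)[of i "Suc j"] nK[OF True] sj by simp
          finally show ?thesis .
        qed
        then show ?thesis using fk g(4) by simp
      qed
    qed
  qed (rule K)
qed

text \<open>
  Iterated refinement, with steps of size \<open>e / 2 ^ n\<close>, gives step functions on the unit interval that
  converge uniformly in the compact set \<open>X\<close>. Their jumps tend to \<open>0\<close>, so the limit is continuous.
\<close>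

lemma close_joined_imp_path:
  fixes X :: "'a::metric_space set"
  assumes X: "compact X" and lc: "locally connected X" and e: "e > 0" and uv: "close_joined X e u v"
  obtains p where "path p" "path_image p \<subseteq> X \<inter> cball u (3 * e)" "pathstart p = u" "pathfinish p = v"
proof -
  \<comment> \<open>A stage is a chain of \<open>M\<close> steps of size \<open>e / 2 ^ n\<close>; \<open>Q\<close> describes the stages and \<open>T\<close> the transitions.\<close>
  define Q where "Q = (\<lambda>n (M, f). M > (0::nat) \<and> f 0 = u \<and> (\<forall>i\<ge>M. f i = v) \<and>
     (n = 0 \<longrightarrow> (\<forall>i. dist u (f i) \<le> e)) \<and>
     (\<forall>i. close_joined X (e / 2 ^ n) (f i) (f (Suc i))))"
  define T where "T = (\<lambda>n (M, f :: nat \<Rightarrow> 'a) (M', f' :: nat \<Rightarrow> 'a). \<exists>K>0. M' = M * K \<and>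
     (\<forall>i j. j < K \<longrightarrow> dist (f i) (f' (i * K + j)) < e / 2 ^ n))"
  have uvX: "u \<in> X" "v \<in> X" using uv unfolding close_joined_def by auto
  have Q0: "Q 0 (1, \<lambda>i. if i = 0 then u else v)"
    unfolding Q_def using uv close_joined_refl[OF uvX(2) e] e
    by (auto simp: close_joined_def intro!: less_imp_le)
  have "\<exists>S. \<forall>n. Q n (S n) \<and> T n (S n) (S (Suc n))"
  proof (rule dependent_nat_choice)
    show "\<exists>x. Q 0 x" using Q0 by blast
    fix x n assume x: "Q n x"
    obtain M f where Mf: "x = (M, f)" by (cases x)
    from x Mf have q: "M > 0" "f 0 = u" "\<And>i. i\<ge>M \<Longrightarrow> f i = v"
      "\<And>i. close_joined X (e / 2 ^ n) (f i) (f (Suc i))" unfolding Q_def by auto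
    have "e / 2 ^ Suc n > 0" using e by simp
    from close_joined_refine[where f = f and v = v and M = M and e = "e / 2 ^ n", OF lc this q(4) q(3)] obtain K f' where
      K: "K > 0" "\<And>i. close_joined X (e / 2 ^ Suc n) (f' i) (f' (Suc i))" "\<And>i. i \<ge> M * K \<Longrightarrow> f' i = v"
      "\<And>i. f' (i * K) = f i" "\<And>i j. j < K \<Longrightarrow> dist (f i) (f' (i * K + j)) < e / 2 ^ n" by metis
    have "f' 0 = u" using K(4)[of 0] q(2) by simp
    then have "Q (Suc n) (M * K, f') \<and> T n x (M * K, f')"
      unfolding Q_def T_def Mf using K q by auto
    then show "\<exists>y. Q (Suc n) y \<and> T n x y" by blast
  qed
  then obtain S where S: "\<And>n. Q n (S n)" "\<And>n. T n (S n) (S (Suc n))" by blast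
  define M f where "M = (\<lambda>n. fst (S n))" and "f = (\<lambda>n. snd (S n))"
  have M0: "M n > 0" and f0: "f n 0 = u" and f1: "i \<ge> M n \<Longrightarrow> f n i = v"
    and fj: "close_joined X (e / 2 ^ n) (f n i) (f n (Suc i))" for n i
    using S(1)[of n] unfolding Q_def M_def f_def by (auto split: prod.splits)
  have f00: "dist u (f 0 i) \<le> e" for i
    using S(1)[of 0] unfolding Q_def M_def f_def by (auto split: prod.splits)
  have fT: "\<exists>K>0. M (Suc n) = M n * K \<and> (\<forall>i j. j < K \<longrightarrow> dist (f n i) (f (Suc n) (i * K + j)) < e / 2 ^ n)" for n
    using S(2)[of n] unfolding T_def M_def f_def by (auto split: prod.splits)
  have fX: "f n i \<in> X" for n i using fj[of n i] unfolding close_joined_def by blast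
  \<comment> \<open>the step function on \<open>M n\<close> equal intervals\<close>
  define F where "F = (\<lambda>n t. f n (nat \<lfloor>t * real (M n)\<rfloor>))"
  have FX: "F n t \<in> X" for n t unfolding F_def by (rule fX)
  have F0: "F n 0 = u" and F1: "F n 1 = v" for n
    unfolding F_def using f0 f1[of n "M n"] by auto
  have step: "dist (F n t) (F (Suc n) t) < e / 2 ^ n" if "t \<ge> 0" for n t
  proof -
    obtain K where K: "K > 0" "M (Suc n) = M n * K"
      "\<And>i j. j < K \<Longrightarrow> dist (f n i) (f (Suc n) (i * K + j)) < e / 2 ^ n" using fT by blast
    define k where "k = nat \<lfloor>t * real (M (Suc n))\<rfloor>"
    have "\<lfloor>t * real (M n)\<rfloor> = \<lfloor>t * real (M (Suc n)) / real_of_int (int K)\<rfloor>"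
      using K by (simp add: field_simps)
    also have "\<dots> = \<lfloor>t * real (M (Suc n))\<rfloor> div int K"
      using K floor_divide_real_eq_div[of "int K" "t * real (M (Suc n))"] by simp
    finally have "nat \<lfloor>t * real (M n)\<rfloor> = k div K"
      unfolding k_def by (simp add: nat_div_distrib that)
    moreover have "f (Suc n) k = f (Suc n) (k div K * K + k mod K)" by simp
    ultimately show ?thesis using K(3)[of "k mod K" "k div K"] K(1)
      unfolding F_def k_def[symmetric] by simp
  qed
  have steps: "dist (F n t) (F (n + k) t) \<le> 2 * e / 2 ^ n - 2 * e / 2 ^ (n + k)" if "t \<ge> 0" for n k t
  proof (induction k)
    case (Suc k)
    have "dist (F n t) (F (n + Suc k) t) \<le> dist (F n t) (F (n + k) t) + dist (F (n + k) t) (F (Suc (n + k)) t)"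
      using dist_triangle by simp
    also have "\<dots> \<le> 2 * e / 2 ^ n - 2 * e / 2 ^ (n + k) + e / 2 ^ (n + k)"
      using Suc step[OF that, of "n + k"] by simp
    also have "\<dots> = 2 * e / 2 ^ n - 2 * e / 2 ^ (n + Suc k)" by (simp add: field_simps)
    finally show ?case .
  qed simp
  have small: "\<exists>n. c * e / 2 ^ n < d" if "d > 0" for c d :: real
  proof -
    have "(\<lambda>n. c * e * (1/2) ^ n) \<longlonglongrightarrow> c * e * 0"
      by (intro tendsto_intros LIMSEQ_realpow_zero) auto
    then have "eventually (\<lambda>n. c * e * (1/2) ^ n < d) sequentially"
      using that by (simp add: order_tendstoD)
    then show ?thesis by (auto simp: eventually_sequentially power_one_over)
  qed
  have "\<exists>l\<in>X. (\<lambda>n. F n t) \<longlonglongrightarrow> l" if t: "t \<ge> 0" for t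
  proof -
    have "Cauchy (\<lambda>n. F n t)"
    proof (rule metric_CauchyI)
      fix d :: real assume d: "d > 0"
      obtain N where N: "4 * e / 2 ^ N < d" using small[OF d] by blast
      have 1: "dist (F N t) (F m t) \<le> 2 * e / 2 ^ N" if "m \<ge> N" for m
      proof -
        have "2 * e / 2 ^ (N + (m - N)) \<ge> 0" using e by simp
        then show ?thesis using steps[OF t, of N "m - N"] that by simp
      qed
      have 2: "4 * e / 2 ^ N = 2 * e / 2 ^ N + 2 * e / 2 ^ N" by simp
      have "dist (F m t) (F n t) < d" if "m \<ge> N" "n \<ge> N" for m n
      proof -
        have "dist (F m t) (F n t) \<le> 2 * e / 2 ^ N + 2 * e / 2 ^ N"
          using dist_triangle3[of "F m t" "F n t" "F N t"] 1[OF that(1)] 1[OF that(2)] by linarith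
        then show ?thesis using N 2 by linarith
      qed
      then show "\<exists>N. \<forall>m\<ge>N. \<forall>n\<ge>N. dist (F m t) (F n t) < d" by blast
    qed
    then show ?thesis
      using compact_imp_complete[OF X, unfolded complete_def, rule_format, of "\<lambda>n. F n t"] FX by simp
  qed
  then obtain g where g: "\<And>t. t \<ge> 0 \<Longrightarrow> g t \<in> X" "\<And>t. t \<ge> 0 \<Longrightarrow> (\<lambda>n. F n t) \<longlonglongrightarrow> g t"
    by metis
  have Fg: "dist (F n t) (g t) \<le> 2 * e / 2 ^ n" if "t \<ge> 0" for n t
  proof (rule Lim_bounded[where M = n])
    show "(\<lambda>m. dist (F n t) (F m t)) \<longlonglongrightarrow> dist (F n t) (g t)"
      by (intro tendsto_intros g that)
    show "\<forall>m\<ge>n. dist (F n t) (F m t) \<le> 2 * e / 2 ^ n"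
    proof (intro allI impI)
      fix m assume "m \<ge> n"
      moreover have "2 * e / 2 ^ (n + (m - n)) \<ge> 0" using e by simp
      ultimately show "dist (F n t) (F m t) \<le> 2 * e / 2 ^ n" using steps[OF that, of n "m - n"] by simp
    qed
  qed
  have fstep: "dist (f n i) (f n j) < e / 2 ^ n" if "i \<le> Suc j" "j \<le> Suc i" for n i j
  proof -
    have *: "dist (f n k) (f n (Suc k)) < e / 2 ^ n" for k
      using fj[of n k] unfolding close_joined_def by blast
    have "i = j \<or> i = Suc j \<or> j = Suc i" using that by auto
    then show ?thesis using * e by (auto simp: dist_commute)
  qed
  have cont: "continuous_on {0..1} g"
    unfolding continuous_on_iff
  proof (intro ballI allI impI)
    fix t d :: real assume t: "t \<in> {0..1}" and d: "d > 0"
    obtain n where n: "5 * e / 2 ^ n < d" using small[OF d] by blast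
    have "dist (g s) (g t) < d" if s: "s \<in> {0..1}" "dist s t < 1 / real (M n)" for s
    proof -
      have "\<bar>s - t\<bar> * real (M n) < 1" using s(2) M0[of n] by (simp add: dist_real_def field_simps)
      then have "\<bar>s * real (M n) - t * real (M n)\<bar> < 1" by (simp add: abs_mult left_diff_distrib[symmetric])
      then have "\<lfloor>s * real (M n)\<rfloor> \<le> \<lfloor>t * real (M n)\<rfloor> + 1" "\<lfloor>t * real (M n)\<rfloor> \<le> \<lfloor>s * real (M n)\<rfloor> + 1"
        by linarith+
      then have "dist (F n s) (F n t) < e / 2 ^ n"
        unfolding F_def by (intro fstep) linarith+
      moreover have "dist (g s) (g t) \<le> dist (F n s) (g s) + dist (F n s) (F n t) + dist (F n t) (g t)"
        using dist_triangle3[of "g s" "g t" "F n s"] dist_triangle[of "F n s" "g t" "F n t"] by simp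
      ultimately have "dist (g s) (g t) < 2 * e / 2 ^ n + e / 2 ^ n + 2 * e / 2 ^ n"
        using Fg[of s n] Fg[of t n] s t by auto
      then show ?thesis using n by (simp add: add_divide_distrib[symmetric])
    qed
    then show "\<exists>\<delta>>0. \<forall>s\<in>{0..1}. dist s t < \<delta> \<longrightarrow> dist (g s) (g t) < d"
      using M0[of n] by (intro exI[of _ "1 / real (M n)"]) auto
  qed
  have gF: "dist u (g t) \<le> 3 * e" if "t \<ge> 0" "t \<le> 1" for t
  proof -
    have "dist u (F 0 t) \<le> e" unfolding F_def by (rule f00)
    moreover have "dist (F 0 t) (g t) \<le> 2 * e" using Fg[of t 0] that by simp
    ultimately show ?thesis using dist_triangle[of u "g t" "F 0 t"] by simp
  qed
  have g01: "g 0 = u" "g 1 = v"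
    using g(2)[of 0] g(2)[of 1] F0 F1 LIMSEQ_unique[OF tendsto_const] by auto
  show thesis
  proof (rule that[of g])
    show "path g" using cont by (simp add: path_def)
    show "path_image g \<subseteq> X \<inter> cball u (3 * e)" using g(1) gF by (auto simp: path_image_def)
  qed (use g01 in \<open>simp_all add: pathstart_def pathfinish_def\<close>)
qed

lemma compact_locally_connected_imp_locally_path_connected:
  fixes X :: "'a::metric_space set"
  assumes "compact X" and lc: "locally connected X"
  shows "locally path_connected X"
  unfolding locally_path_connected_im_kleinen
proof (intro allI impI, elim conjE)
  fix V x assume V: "openin (top_of_set X) V" "x \<in> V"
  then obtain d where d: "d > 0" "ball x d \<inter> X \<subseteq> V"
    by (auto simp: openin_contains_ball)
  have x: "x \<in> X" using V openin_imp_subset by blast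
  have e: "d / 4 > 0" using d by simp
  obtain U where U: "openin (top_of_set X) U" "x \<in> U" "\<And>y. y \<in> U \<Longrightarrow> close_joined X (d/4) x y"
    using close_joined_nhd[OF lc x e] by blast
  have "\<exists>p. path p \<and> path_image p \<subseteq> V \<and> pathstart p = x \<and> pathfinish p = y" if y: "y \<in> U" for y
  proof -
    obtain p where "path p" "path_image p \<subseteq> X \<inter> cball x (3 * (d/4))" "pathstart p = x" "pathfinish p = y"
      using close_joined_imp_path[OF assms e U(3)[OF y]] by blast
    moreover have "X \<inter> cball x (3 * (d/4)) \<subseteq> V" using d by fastforce
    ultimately show ?thesis by blast
  qed
  moreover have "U \<subseteq> V"
  proof
    fix y assume "y \<in> U"
    then have "y \<in> X" "dist x y < d/4" using U(3)[of y] unfolding close_joined_def by auto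
    then show "y \<in> V" using d by auto
  qed
  ultimately show "\<exists>U. openin (top_of_set X) U \<and> x \<in> U \<and> U \<subseteq> V \<and>
      (\<forall>y. y \<in> U \<longrightarrow> (\<exists>p. path p \<and> path_image p \<subseteq> V \<and> pathstart p = x \<and> pathfinish p = y))"
    using U by blast
qed

section \<open>Non-cut points\<close>

text \<open>
  Fix a base point. If every point were a cut point, the set \<open>B p\<close> of points that \<open>p\<close> cuts off from the
  base point (together with \<open>p\<close>) would contain some \<open>q \<noteq> p\<close>, and then \<open>B q\<close> would be a smaller set of
  the same kind. By compactness and Zorn's lemma there is a minimal one.
\<close>

lemma exists_non_cut_point:
  fixes X :: "'a::metric_space set"
  assumes X: "compact X" "connected X" "X \<noteq> {}" and lc: "locally connected X"
  shows "\<exists>p\<in>X. connected (X - {p})"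
proof (rule ccontr)
  assume "\<not> ?thesis"
  then have cut: "\<not> connected (X - {p})" if "p \<in> X" for p using that by blast
  obtain o' where o: "o' \<in> X" using X by blast
  define Q where "Q = (\<lambda>p. connected_component_set (X - {p}) o')"
  \<comment> \<open>Minimal sets \<open>B p\<close> correspond to maximal sets \<open>Q p\<close>, the form in which Zorn is applied.\<close>
  define B where "B = (\<lambda>p. X - Q p)"
  have openQ: "openin (top_of_set X) (Q p)" if "p \<in> X" "p \<noteq> o'" for p
  proof -
    have "openin (top_of_set X) (X - {p})" by (simp add: openin_delete)
    then show ?thesis using lc o that unfolding Q_def locally_connected_open_connected_component by blast
  qed
  have oQ: "o' \<in> Q p" if "p \<noteq> o'" for p using o that unfolding Q_def by auto
  have QX: "Q p \<subseteq> X - {p}" for p unfolding Q_def by (rule connected_component_subset)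
  have closedB: "closed (B p)" if p: "p \<in> X" "p \<noteq> o'" for p
  proof -
    obtain T where "open T" "Q p = X \<inter> T" using openQ[OF p] by (auto simp: openin_open)
    then have "B p = X \<inter> - T" unfolding B_def by blast
    then show ?thesis using X(1) \<open>open T\<close> by (simp add: closed_Compl compact_imp_closed closed_Int)
  qed
  have conn: "connected (insert p (Q p))" if p: "p \<in> X" "p \<noteq> o'" for p
  proof -
    have "p \<in> closure (Q p)"
    proof (rule ccontr)
      assume np: "p \<notin> closure (Q p)"
      have "X \<inter> closure (Q p) \<subseteq> Q p"
      proof -
        have "closedin (top_of_set (X - {p})) (Q p)"
          unfolding Q_def by (rule closedin_connected_component)
        then obtain T where T: "closed T" "Q p = (X - {p}) \<inter> T" by (auto simp: closedin_closed)
        then have "closure (Q p) \<subseteq> T" by (simp add: closure_minimal)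
        then have "(X - {p}) \<inter> closure (Q p) \<subseteq> Q p" using T by blast
        then show ?thesis using np by blast
      qed
      then have "X \<inter> closure (Q p) = Q p" using closure_subset[of "Q p"] QX[of p] by blast
      then have "closedin (top_of_set X) (Q p)" by (metis closed_closure closedin_closed_Int)
      then have "Q p = {} \<or> Q p = X" using X(2) openQ[OF p] by (auto simp: connected_clopen)
      then show False using oQ[OF p(2)] QX[of p] p by blast
    qed
    moreover have "connected (Q p)" unfolding Q_def by (rule connected_connected_component)
    ultimately show ?thesis
      using closure_subset[of "Q p"] by (intro connected_intermediate_closure[of "Q p" "insert p (Q p)"]) blast+
  qed
  have Bsub: "q \<noteq> o' \<and> B q \<subseteq> B p - {p}" if p: "p \<in> X" "p \<noteq> o'" and q: "q \<in> B p" "q \<noteq> p" for p q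
  proof -
    have "q \<notin> insert p (Q p)" "insert p (Q p) \<subseteq> X" using q QX[of p] p unfolding B_def by auto
    moreover have "o' \<in> insert p (Q p)" using oQ[OF p(2)] by simp
    ultimately have "insert p (Q p) \<subseteq> Q q"
      using conn[OF p] QX connected_component_maximal[of o' "insert p (Q p)" "X - {q}"]
      by (simp add: Q_def subset_Diff_insert)
    then show ?thesis using oQ[OF p(2)] q unfolding B_def by auto
  qed
  have Bne: "\<exists>q. q \<in> B p \<and> q \<noteq> p" if p: "p \<in> X" "p \<noteq> o'" for p
  proof (rule ccontr)
    assume "\<not> ?thesis"
    then have "Q p = X - {p}" using QX[of p] unfolding B_def by blast
    then show False using cut[OF p(1)] unfolding Q_def by (metis connected_connected_component)
  qed
  let ?F = "Q ` (X - {o'})"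
  have "\<exists>M\<in>?F. \<forall>Y\<in>?F. M \<subseteq> Y \<longrightarrow> Y = M"
  proof (rule subset_Zorn)
    fix C assume C: "subset.chain ?F C"
    show "\<exists>U\<in>?F. \<forall>Y\<in>C. Y \<subseteq> U"
    proof (cases "C = {}")
      case True
      have "\<not> connected (X - {o'})" using cut o by blast
      then have "X - {o'} \<noteq> {}" by (metis connected_empty)
      then show ?thesis using True by blast
    next
      case False
      have Csub: "C \<subseteq> ?F" using C by (simp add: subset_chain_def)
      have lin: "\<And>a b. a \<in> C \<Longrightarrow> b \<in> C \<Longrightarrow> a \<subseteq> b \<or> b \<subseteq> a" using C by (auto simp: subset_chain_def)
      \<comment> \<open>Any point cut off by all members of the chain gives an upper bound.\<close>
      have "X \<inter> \<Inter>((\<lambda>S. X - S) ` C) \<noteq> {}"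
      proof (rule compact_imp_fip[OF X(1)])
        fix T assume "T \<in> (\<lambda>S. X - S) ` C"
        then show "closed T" using Csub closedB unfolding B_def by blast
      next
        fix F' assume F': "finite F'" "F' \<subseteq> (\<lambda>S. X - S) ` C"
        then obtain D where D: "D \<subseteq> C" "finite D" "F' = (\<lambda>S. X - S) ` D"
          by (meson finite_subset_image)
        show "X \<inter> \<Inter>F' \<noteq> {}"
        proof (cases "D = {}")
          case True then show ?thesis using D X by simp
        next
          case False
          then have "\<Union>D \<in> D" using D lin by (intro Union_in_chain) (auto simp: subset_chain_def)
          then obtain p where p: "p \<in> X" "p \<noteq> o'" "\<Union>D = Q p" using D Csub by blast
          then have "p \<in> X \<inter> \<Inter>F'" using QX[of p] unfolding D by blast
          then show ?thesis by blast
        qed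
      qed
      then obtain z where z: "z \<in> X" "\<And>S. S \<in> C \<Longrightarrow> z \<notin> S" by blast
      have zo: "z \<noteq> o'" using False z(2) Csub oQ by blast
      have "Q p \<subseteq> Q z" if p: "p \<in> X" "p \<noteq> o'" "Q p \<in> C" for p
      proof (cases "z = p")
        case False
        have "z \<in> B p" using z p unfolding B_def by blast
        then have "B z \<subseteq> B p" using Bsub[OF p(1,2)] False by blast
        then show ?thesis using QX[of p] QX[of z] unfolding B_def by blast
      qed simp
      then have "\<forall>Y\<in>C. Y \<subseteq> Q z" using Csub by force
      moreover have "Q z \<in> ?F" using z zo by simp
      ultimately show ?thesis by (intro bexI[of _ "Q z"])
    qed
  qed
  then obtain p where p: "p \<in> X" "p \<noteq> o'" and max: "\<And>q. q \<in> X \<Longrightarrow> q \<noteq> o' \<Longrightarrow> Q p \<subseteq> Q q \<Longrightarrow> Q q = Q p"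
    by blast
  obtain q where q: "q \<in> B p" "q \<noteq> p" using Bne[OF p] by blast
  then have qX: "q \<in> X" "q \<noteq> o'" "B q \<subseteq> B p - {p}" using Bsub[OF p] unfolding B_def by auto
  then have "Q p \<subseteq> Q q" "p \<in> Q q" using QX[of p] p unfolding B_def by auto
  then show False using max[OF qX(1,2)] QX[of p] by blast
qed

section \<open>Minimal separating subarcs\<close>

text \<open>
  A path that joins \<open>x\<close> to \<open>y\<close> off \<open>\<alpha> ` {0..s}\<close> has a compact image, so it also misses a slightly longer
  piece. Hence the times at which the initial piece does not separate form a half-open
  interval, and the first separating time is attained.
\<close>

lemma first_separating_time:
  fixes \<alpha> :: "real \<Rightarrow> 'a::metric_space"
  assumes \<alpha>: "path \<alpha>"
    and 0: "path_component (X - {\<alpha> 0}) x y"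
    and 1: "\<not> path_component (X - path_image \<alpha>) x y"
  obtains s where "0 < s" "s \<le> 1" "\<not> path_component (X - \<alpha> ` {0..s}) x y"
    "\<And>t. 0 \<le> t \<Longrightarrow> t < s \<Longrightarrow> path_component (X - \<alpha> ` {0..t}) x y"
proof -
  define P where "P = (\<lambda>s. path_component (X - \<alpha> ` {0..s}) x y)"
  have mono: "P s" if "P t" "s \<le> t" for s t
  proof -
    have "X - \<alpha> ` {0..t} \<subseteq> X - \<alpha> ` {0..s}" using that(2) by auto
    then show ?thesis using that(1) path_component_of_subset unfolding P_def by blast
  qed
  have ext: "\<exists>s'>s. P s'" if s: "P s" "0 \<le> s" "s < 1" for s
  proof -
    obtain p where p: "path p" "path_image p \<subseteq> X - \<alpha> ` {0..s}" "pathstart p = x" "pathfinish p = y"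
      using s(1) unfolding P_def path_component_def by blast
    define T where "T = {s..1} \<inter> \<alpha> -` path_image p"
    have "continuous_on {s..1} \<alpha>"
      using \<alpha> s unfolding path_def by (auto intro: continuous_on_subset)
    then have "closedin (top_of_set {s..1}) T"
      unfolding T_def using p(1)
      by (intro continuous_closedin_preimage) (auto simp: compact_path_image compact_imp_closed)
    then have cT: "compact T" by (metis closedin_compact compact_Icc)
    have sT: "s \<notin> T" using p(2) s(2) unfolding T_def by auto
    have "\<exists>s'>s. \<forall>t\<in>T. s' < t"
    proof (cases "T = {}")
      case False
      then obtain m where m: "m \<in> T" "\<And>t. t \<in> T \<Longrightarrow> m \<le> t"
        using compact_attains_inf[OF cT] by blast
      have "s < m" using m(1) sT unfolding T_def by (auto simp: less_le)
      then show ?thesis using m(2) by (intro exI[of _ "(s + m) / 2"]) force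
    qed (auto intro: gt_ex)
    then obtain s' where s': "s' > s" "\<And>t. t \<in> T \<Longrightarrow> s' < t" by blast
    let ?s = "min s' 1"
    have "path_image p \<inter> \<alpha> ` {0..?s} = {}"
    proof (rule ccontr)
      assume "\<not> ?thesis"
      then obtain t where t: "t \<in> {0..?s}" "\<alpha> t \<in> path_image p" by blast
      then have "t \<notin> {0..s}" using p(2) by blast
      then have "t \<in> T" using t unfolding T_def by auto
      then show False using s'(2) t by force
    qed
    then have "P ?s" unfolding P_def path_component_def using p by blast
    then show ?thesis using s' s by (intro exI[of _ ?s]) auto
  qed
  define W where "W = {s. 0 \<le> s \<and> s \<le> 1 \<and> P s}"
  have P0: "P 0" using 0 unfolding P_def by simp
  have nP1: "\<not> P 1" using 1 unfolding P_def path_image_def by simp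
  have W0: "0 \<in> W" using P0 unfolding W_def by simp
  have bdd: "bdd_above W" unfolding W_def by (auto intro: bdd_aboveI[of _ 1])
  define s where "s = Sup W"
  have "W \<noteq> {}" using W0 by blast
  then have s1: "s \<le> 1" unfolding s_def by (rule cSup_least) (simp add: W_def)
  have s0: "0 \<le> s" unfolding s_def using W0 bdd by (rule cSup_upper)
  have nP: "\<not> P s"
  proof
    assume Ps: "P s"
    then have "s \<noteq> 1" using nP1 by auto
    then obtain s' where "s' > s" "P s'" using ext[OF Ps s0] s1 by auto
    then have "P (min s' 1)" using mono by auto
    then have "min s' 1 \<in> W" unfolding W_def using s0 \<open>s' > s\<close> by auto
    then have "min s' 1 \<le> s" unfolding s_def using bdd by (rule cSup_upper)
    then show False using \<open>s' > s\<close> s1 \<open>s \<noteq> 1\<close> by auto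
  qed
  have "s \<noteq> 0" using nP P0 by auto
  show thesis
  proof (rule that[of s])
    show "path_component (X - \<alpha> ` {0..t}) x y" if t: "0 \<le> t" "t < s" for t
    proof -
      obtain w where "w \<in> W" "t < w" using t less_cSup_iff[OF _ bdd] W0 unfolding s_def by blast
      then show ?thesis using mono[of w t] unfolding W_def P_def by auto
    qed
  qed (use nP s0 s1 \<open>s \<noteq> 0\<close> in \<open>auto simp: P_def\<close>)
qed

lemma arc_affine_subarc:
  fixes \<alpha> :: "real \<Rightarrow> 'a::topological_space"
  assumes \<alpha>: "arc \<alpha>" and uv: "u \<in> {0..1}" "v \<in> {0..1}" "u \<noteq> v"
  shows "arc (\<lambda>t. \<alpha> (u + (v - u) * t))"
proof -
  have in01: "u + (v - u) * t \<in> {0..1}" if "t \<in> {0..1}" for t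
  proof -
    have "u + (v - u) * t = (1 - t) * u + t * v" by (simp add: algebra_simps)
    then show ?thesis using convexD_alt[OF convex_real_interval(5)[of 0 1], of u v t] uv that by simp
  qed
  have "continuous_on {0..1} (\<lambda>t. \<alpha> (u + (v - u) * t))"
    by (rule continuous_on_compose2[of "{0..1}" \<alpha>])
      (use \<alpha> in01 in \<open>auto simp: arc_def path_def intro!: continuous_intros\<close>)
  moreover have "inj_on (\<lambda>t. \<alpha> (u + (v - u) * t)) {0..1}"
  proof (rule inj_onI)
    fix s t :: real
    assume st: "s \<in> {0..1}" "t \<in> {0..1}" and eq: "\<alpha> (u + (v - u) * s) = \<alpha> (u + (v - u) * t)"
    have "u + (v - u) * s = u + (v - u) * t"
      using \<alpha> eq in01[OF st(1)] in01[OF st(2)] unfolding arc_def inj_on_def by blast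
    then show "s = t" using uv(3) by simp
  qed
  ultimately show ?thesis by (simp add: arc_def path_def)
qed

text \<open>
  The end of the arc is moved to the first separating time, and the reversed arc is then treated in
  the same way. The condition on single points keeps the result from being degenerate.
\<close>

lemma minimal_separating_subarc:
  fixes \<alpha> :: "real \<Rightarrow> 'a::metric_space"
  assumes \<alpha>: "arc \<alpha>"
    and pt: "\<And>p. p \<in> path_image \<alpha> \<Longrightarrow> path_component (X - {p}) x y"
    and sep: "\<not> path_component (X - path_image \<alpha>) x y"
  obtains \<gamma> where "arc \<gamma>" "path_image \<gamma> \<subseteq> path_image \<alpha>"
    "\<not> path_component (X - path_image \<gamma>) x y"
    "\<And>s. 0 \<le> s \<Longrightarrow> s < 1 \<Longrightarrow> path_component (X - \<gamma> ` {0..s}) x y"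
    "\<And>s. 0 < s \<Longrightarrow> s \<le> 1 \<Longrightarrow> path_component (X - \<gamma> ` {s..1}) x y"
proof -
  have "\<alpha> 0 \<in> path_image \<alpha>" by (simp add: path_image_def)
  then obtain b where b: "0 < b" "b \<le> 1" "\<not> path_component (X - \<alpha> ` {0..b}) x y"
    "\<And>t. 0 \<le> t \<Longrightarrow> t < b \<Longrightarrow> path_component (X - \<alpha> ` {0..t}) x y"
    using first_separating_time[OF arc_imp_path[OF \<alpha>] pt sep] by metis
  define \<beta> where "\<beta> = (\<lambda>t. \<alpha> (b + (0 - b) * t))"
  have arc\<beta>: "arc \<beta>" unfolding \<beta>_def using \<alpha> b by (intro arc_affine_subarc) auto
  have "(\<lambda>t. b + (0 - b) * t) ` {0..1} = {0..b}"
    using b image_affinity_atLeastAtMost[where m = "- b" and c = b and a = 0 and b = "1::real"] by (simp add: algebra_simps)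
  then have im\<beta>: "path_image \<beta> = \<alpha> ` {0..b}"
    unfolding \<beta>_def path_image_def by (metis image_image)
  have \<beta>0: "\<beta> 0 \<in> path_image \<alpha>" using b unfolding \<beta>_def path_image_def by auto
  have nsep: "\<not> path_component (X - path_image \<beta>) x y" using b(3) im\<beta> by simp
  obtain c where c: "0 < c" "c \<le> 1" "\<not> path_component (X - \<beta> ` {0..c}) x y"
    "\<And>t. 0 \<le> t \<Longrightarrow> t < c \<Longrightarrow> path_component (X - \<beta> ` {0..t}) x y"
    using first_separating_time[OF arc_imp_path[OF arc\<beta>] pt[OF \<beta>0] nsep] by metis
  define \<gamma> where "\<gamma> = (\<lambda>t. \<beta> (0 + (c - 0) * t))"
  have \<gamma>: "\<gamma> t = \<beta> (c * t)" "\<beta> t = \<alpha> (b * (1 - t))" for t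
    unfolding \<gamma>_def \<beta>_def by (simp_all add: algebra_simps)
  have im\<gamma>: "path_image \<gamma> = \<beta> ` {0..c}" 
  proof -
    have "(\<lambda>t. 0 + (c - 0) * t) ` {0..1} = {0..c}"
      using c image_mult_atLeastAtMost[OF c(1), of 0 1] by simp
    then show ?thesis unfolding \<gamma>_def path_image_def by (metis image_image)
  qed
  show thesis
  proof (rule that[of \<gamma>])
    show "arc \<gamma>" unfolding \<gamma>_def using arc\<beta> c by (intro arc_affine_subarc) auto
    show "path_image \<gamma> \<subseteq> path_image \<alpha>"
      using im\<gamma> im\<beta> b c unfolding path_image_def by fastforce
    show "\<not> path_component (X - path_image \<gamma>) x y" using c im\<gamma> by simp
    show "path_component (X - \<gamma> ` {0..s}) x y" if s: "0 \<le> s" "s < 1" for s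
    proof -
      have "\<gamma> ` {0..s} \<subseteq> \<beta> ` {0..c * s}" using c s by (auto simp: \<gamma> mult_left_mono)
      moreover have "path_component (X - \<beta> ` {0..c * s}) x y" using c s by (intro c(4)) auto
      ultimately show ?thesis by (meson Diff_mono order_refl path_component_of_subset)
    qed
    show "path_component (X - \<gamma> ` {s..1}) x y" if s: "0 < s" "s \<le> 1" for s
    proof -
      have "b * (1 - c * t) \<in> {0..b * (1 - c * s)}" if "t \<in> {s..1}" for t
        using that b c s by (auto simp: mult_le_one mult_left_mono)
      then have "\<gamma> ` {s..1} \<subseteq> \<alpha> ` {0..b * (1 - c * s)}" unfolding \<gamma> by blast
      moreover have "path_component (X - \<alpha> ` {0..b * (1 - c * s)}) x y"
        using c s b by (intro b(4)) (auto simp: mult_le_one)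
      ultimately show ?thesis by (meson Diff_mono order_refl path_component_of_subset)
    qed
  qed
qed

section \<open>Homeomorphisms close to the identity\<close>

text \<open>
  A weak form of Effros' theorem. Every homeomorphism gets one of countably many codes, which
  determines its inverse up to \<open>e\<close> in the uniform distance. By Baire's theorem, for some code the
  images of \<open>p\<close> under the homeomorphisms with that code are dense in a nonempty open set \<open>U\<close>. If
  \<open>h\<^sub>0\<close> is one of them with \<open>h\<^sub>0 p \<in> U\<close>, then \<open>h\<^sub>0 ` W\<close> meets \<open>U\<close>, so it contains \<open>h p\<close> for some \<open>h\<close> with the
  same code, and \<open>inv h\<^sub>0 \<circ> h\<close> is the required homeomorphism.
\<close>

lemma approximate_homogeneity:
  fixes X :: "'a::metric_space set"
  assumes X: "compact X"
    and hom: "\<And>x y. x \<in> X \<Longrightarrow> y \<in> X \<Longrightarrow> \<exists>h k. homeomorphism X X h k \<and> h x = y"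
    and p: "p \<in> X" and e: "e > 0"
    and W: "openin (top_of_set X) W" "p \<in> closure W"
  obtains h k where "homeomorphism X X h k" "h p \<in> W" "\<And>x. x \<in> X \<Longrightarrow> dist (k x) x < e"
proof -
  have net: "\<exists>F. finite F \<and> F \<subseteq> X \<and> X \<subseteq> (\<Union>a\<in>F. ball a r)" if "r > 0" for r :: real
  proof -
    have "X \<subseteq> (\<Union>a\<in>X. ball a r)" using that by auto
    then obtain F where "F \<subseteq> X" "finite F" "X \<subseteq> (\<Union>a\<in>F. ball a r)"
      using compactE_image[OF X, of X "\<lambda>a. ball a r"] open_ball by blast
    then show ?thesis by blast
  qed
  have "\<exists>F. \<forall>n. finite (F n) \<and> F n \<subseteq> X \<and> X \<subseteq> (\<Union>a\<in>F n. ball a (1 / real (Suc n)))"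
    by (intro choice allI net) simp
  then obtain F where F: "\<And>n. finite (F n)" "\<And>n. F n \<subseteq> X" "\<And>n. X \<subseteq> (\<Union>a\<in>F n. ball a (1 / real (Suc n)))"
    by blast
  obtain V where V: "finite V" "V \<subseteq> X" "X \<subseteq> (\<Union>a\<in>V. ball a (e/4))" using net[of "e/4"] e by auto
  \<comment> \<open>A code consists of a scale \<open>n\<close> and a rounding of \<open>k\<close> on the finite net \<open>F n\<close> to values in the finite net \<open>V\<close>.\<close>
  define code where "code = (\<lambda>k :: 'a \<Rightarrow> 'a. \<lambda>(n, c :: 'a \<Rightarrow> 'a). (\<forall>x\<in>X. \<forall>y\<in>X. dist x y < 1 / real (Suc n) \<longrightarrow> dist (k x) (k y) < e/4) \<and>
     (\<forall>a\<in>F n. dist (c a) (k a) < e/4))"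
  have code_ex: "\<exists>s\<in>(SIGMA n:UNIV. PiE (F n) (\<lambda>_. V)). code k s" if k: "continuous_on X k" "k ` X \<subseteq> X" for k
  proof -
    have "uniformly_continuous_on X k" using k X by (simp add: compact_uniformly_continuous)
    then obtain d where d: "d > 0" "\<And>x y. x \<in> X \<Longrightarrow> y \<in> X \<Longrightarrow> dist x y < d \<Longrightarrow> dist (k x) (k y) < e/4"
      using e unfolding uniformly_continuous_on_def by (metis divide_pos_pos zero_less_numeral)
    obtain n where n: "1 / real (Suc n) < d" using nat_approx_posE[OF d(1)] by blast
    have "\<forall>a\<in>F n. \<exists>v\<in>V. dist v (k a) < e/4"
    proof
      fix a assume "a \<in> F n"
      then have "k a \<in> X" using F(2) k by blast
      then have "k a \<in> (\<Union>v\<in>V. ball v (e/4))" using V(3) by blast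
      then show "\<exists>v\<in>V. dist v (k a) < e/4" unfolding UN_iff mem_ball .
    qed
    then obtain c where c: "\<And>a. a \<in> F n \<Longrightarrow> c a \<in> V \<and> dist (c a) (k a) < e/4" by metis
    have "(n, restrict c (F n)) \<in> (SIGMA n:UNIV. PiE (F n) (\<lambda>_. V))" using c by auto
    moreover have "code k (n, restrict c (F n))" unfolding code_def using c n d by auto
    ultimately show ?thesis by blast
  qed
  have code_close: "dist (k x) (k' x) < e" if "code k s" "code k' s" and x: "x \<in> X" for k k' s x
  proof -
    obtain n c where s: "s = (n, c)" by (cases s)
    obtain a where a: "a \<in> F n" "dist a x < 1 / real (Suc n)" using F(3)[of n] x by auto
    have aX: "a \<in> X" using a F(2) by blast
    have "dist (k a) (k x) < e/4" "dist (k' a) (k' x) < e/4" "dist (c a) (k a) < e/4" "dist (c a) (k' a) < e/4"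
      using that a aX unfolding code_def s by auto
    then show ?thesis
      using dist_triangle2[of "k a" "k' a" "c a"] dist_triangle[of "k x" "k' x" "k' a"]
        dist_triangle[of "k x" "k' a" "k a"] by (simp add: dist_commute)
  qed
  define I where "I = (SIGMA n:UNIV. PiE (F n) (\<lambda>_. V))"
  have cI: "countable I"
    unfolding I_def by (intro countable_SIGMA countable_finite[OF finite_PiE]) (use F(1) V(1) in auto)
  define Orb where "Orb = (\<lambda>s. {h p | h k. homeomorphism X X h k \<and> code k s})"
  have OrbX: "Orb s \<subseteq> X" for s unfolding Orb_def using p by (auto simp: homeomorphism_def)
  have cover: "X \<subseteq> (\<Union>s\<in>I. Orb s)"
  proof
    fix y assume "y \<in> X"
    then obtain h k where hk: "homeomorphism X X h k" "h p = y" using hom p by blast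
    then obtain s where "s \<in> I" "code k s" using code_ex[of k] unfolding homeomorphism_def I_def by auto
    then show "y \<in> (\<Union>s\<in>I. Orb s)" using hk unfolding Orb_def by blast
  qed
  let ?T = "top_of_set X"
  have "\<exists>s\<in>I. ?T interior_of (?T closure_of (Orb s)) \<noteq> {}"
  proof (rule ccontr)
    assume "\<not> ?thesis"
    then have "?T interior_of \<Union>((\<lambda>s. ?T closure_of (Orb s)) ` I) = {}"
    proof (intro Baire_category_alt disjI2 conjI)
      have "compact_space ?T" using X by (simp add: compact_space_subtopology)
      then show "locally_compact_space ?T" by (rule compact_imp_locally_compact_space)
      show "regular_space ?T"
        by (simp add: metrizable_imp_regular_space metrizable_space_euclidean metrizable_space_subtopology)
    qed (use cI in auto)
    moreover have "\<Union>((\<lambda>s. ?T closure_of (Orb s)) ` I) = X"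
    proof
      show "\<Union>((\<lambda>s. ?T closure_of (Orb s)) ` I) \<subseteq> X"
        using closure_of_subset_topspace[of ?T] by fastforce
      have "Orb s \<subseteq> ?T closure_of (Orb s)" for s by (rule closure_of_subset) (simp add: OrbX)
      then show "X \<subseteq> \<Union>((\<lambda>s. ?T closure_of (Orb s)) ` I)" using cover by blast
    qed
    ultimately have "?T interior_of X = {}" by simp
    then have "X = {}" using interior_of_topspace[of ?T] by simp
    then show False using p by blast
  qed
  then obtain s where s: "?T interior_of (?T closure_of (Orb s)) \<noteq> {}" by blast
  define U where "U = ?T interior_of (?T closure_of (Orb s))"
  have U: "openin ?T U" "U \<noteq> {}" "U \<subseteq> ?T closure_of (Orb s)"
    using s unfolding U_def by (auto simp: interior_of_subset)
  obtain u where "u \<in> U" using U(2) by blast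
  then have "u \<in> ?T closure_of (Orb s)" using U(3) by blast
  then obtain u' where "u' \<in> Orb s" "u' \<in> U"
    using \<open>u \<in> U\<close> U(1) unfolding in_closure_of by blast
  then obtain h0 k0 where h0: "homeomorphism X X h0 k0" "code k0 s" "h0 p \<in> U" unfolding Orb_def by blast
  have "openin ?T (h0 ` W)" using homeomorphism_imp_open_map[OF h0(1) W(1)] .
  then have op: "openin ?T (U \<inter> h0 ` W)" using U(1) by blast
  have "U \<inter> h0 ` W \<noteq> {}"
  proof -
    have "openin ?T (X \<inter> h0 -` U)"
      using h0(1) by (intro continuous_openin_preimage[OF _ _ U(1)]) (auto simp: homeomorphism_def)
    then obtain N where N: "open N" "X \<inter> h0 -` U = X \<inter> N" by (auto simp: openin_open)
    then have "p \<in> N" using p h0(3) by blast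
    then obtain w where "w \<in> W" "w \<in> N" using W(2) N(1) unfolding closure_iff_nhds_not_empty by (metis disjoint_iff order_refl)
    then show ?thesis using N(2) openin_imp_subset[OF W(1)] by blast
  qed
  then obtain z where z: "z \<in> U \<inter> h0 ` W" by blast
  have "z \<in> ?T closure_of (Orb s)" using z U(3) by blast
  then have "\<forall>N. z \<in> N \<and> openin ?T N \<longrightarrow> (\<exists>y. y \<in> Orb s \<and> y \<in> N)"
    unfolding in_closure_of by (rule conjunct2)
  from this[rule_format, of "U \<inter> h0 ` W", OF conjI[OF z op]]
  obtain y where "y \<in> Orb s" "y \<in> U \<inter> h0 ` W" by auto
  then obtain h k where h: "homeomorphism X X h k" "code k s" "h p \<in> h0 ` W" unfolding Orb_def by blast
  show thesis
  proof (rule that[of "k0 \<circ> h" "k \<circ> h0"])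
    show "homeomorphism X X (k0 \<circ> h) (k \<circ> h0)"
      using h(1) homeomorphism_symD[OF h0(1)] by (rule homeomorphism_compose)
    show "(k0 \<circ> h) p \<in> W"
      using h(3) h0(1) openin_imp_subset[OF W(1)] unfolding homeomorphism_def by force
    fix x assume x: "x \<in> X"
    then have "h0 x \<in> X" "k0 (h0 x) = x" using h0(1) by (auto simp: homeomorphism_def)
    then show "dist ((k \<circ> h0) x) x < e" using code_close[OF h(2) h0(2), of "h0 x"] by simp
  qed
qed

section \<open>Continuous logarithms on the circle\<close>

lemma continuous_logarithms_differ_by_constant:
  fixes f g :: "'a::topological_space \<Rightarrow> complex"
  assumes S: "connected S" and f: "continuous_on S f" and g: "continuous_on S g"
    and eq: "\<And>x. x \<in> S \<Longrightarrow> exp (f x) = exp (g x)"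
    and xy: "x \<in> S" "y \<in> S"
  shows "f x - g x = f y - g y"
proof -
  have "(\<lambda>x. f x - g x) constant_on S"
  proof (rule continuous_discrete_range_constant[OF S])
    show "continuous_on S (\<lambda>x. f x - g x)" by (intro continuous_intros f g)
    fix x assume x: "x \<in> S"
    have "2 * pi \<le> norm ((f y - g y) - (f x - g x))" if y: "y \<in> S" "f y - g y \<noteq> f x - g x" for y
    proof (rule ccontr)
      assume lt: "\<not> ?thesis"
      have "exp (f y - g y) = exp (f x - g x)" using eq x y by (simp add: exp_diff)
      moreover have "\<bar>Im (f y - g y) - Im (f x - g x)\<bar> < 2 * pi"
        using lt abs_Im_le_cmod[of "(f y - g y) - (f x - g x)"] by simp
      ultimately show False using y(2) exp_complex_eqI by blast
    qed
    then show "\<exists>e>0. \<forall>y. y \<in> S \<and> f y - g y \<noteq> f x - g x \<longrightarrow> e \<le> norm ((f y - g y) - (f x - g x))"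
      by (intro exI[of _ "2 * pi"]) auto
  qed
  then show ?thesis using xy unfolding constant_on_def by metis
qed

text \<open>
  For a map from a circle to the punctured plane this says that the winding number around \<open>0\<close>
  vanishes.
\<close>

definition has_logarithm_on :: "'a::topological_space set \<Rightarrow> ('a \<Rightarrow> complex) \<Rightarrow> bool"
  where "has_logarithm_on S f \<longleftrightarrow> (\<exists>g. continuous_on S g \<and> (\<forall>x\<in>S. f x = exp (g x)))"

text \<open>
  The upper half circle is mapped by \<open>p\<close> into the plane slit along the nonpositive reals, the lower
  one by \<open>q\<close> into the plane slit along the nonnegative reals. On each half a logarithm differs from a
  branch of \<open>Ln\<close> by a constant, and the two increments add up to \<open>- 2 * \<i> * pi\<close> instead of \<open>0\<close>.
\<close>

lemma no_logarithm_of_loop_around_zero: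
  fixes p q :: "real \<Rightarrow> complex" and g :: "complex \<Rightarrow> complex"
  assumes p: "continuous_on {0..1} p" "\<And>s. s \<in> {0..1} \<Longrightarrow> p s \<notin> \<real>\<^sub>\<le>\<^sub>0"
    and q: "continuous_on {0..1} q" "\<And>s. s \<in> {0..1} \<Longrightarrow> - q s \<notin> \<real>\<^sub>\<le>\<^sub>0"
    and ends: "p 0 = a" "p 1 = b" "q 0 = b" "q 1 = a" "Im a > 0" "Im b < 0"
    and g: "continuous_on (sphere 0 1) g"
    and upper: "\<And>z. z \<in> sphere 0 1 \<Longrightarrow> Im z \<ge> 0 \<Longrightarrow> exp (g z) = p ((1 - Re z) / 2)"
    and lower: "\<And>z. z \<in> sphere 0 1 \<Longrightarrow> Im z \<le> 0 \<Longrightarrow> exp (g z) = q ((1 + Re z) / 2)"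
  shows False
proof -
  define u where "u = (\<lambda>s::real. Complex (1 - 2 * s) (sqrt (1 - (1 - 2 * s)\<^sup>2)))"
  have sq: "(1 - 2 * s)\<^sup>2 \<le> 1" if "s \<in> {0..1}" for s :: real
    using that by (simp add: abs_square_le_1 abs_le_iff)
  have us: "u s \<in> sphere 0 1" "Im (u s) \<ge> 0" "Re (u s) = 1 - 2 * s"
    "- u s \<in> sphere 0 1" "Im (- u s) \<le> 0" "Re (- u s) = 2 * s - 1" if "s \<in> {0..1}" for s
    using sq[OF that] by (auto simp: u_def cmod_def power2_commute[of 1])
  have contu: "continuous_on {0..1} u" unfolding u_def
    by (auto simp: Complex_eq intro!: continuous_intros)
  have u01: "u 0 = 1" "u 1 = -1" by (simp_all add: u_def complex_eq_iff)
  have g1: "continuous_on {0..1} (\<lambda>s. g (u s))" "continuous_on {0..1} (\<lambda>s. g (- u s))"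
    using us by (auto intro!: continuous_on_compose2[OF g] continuous_intros contu)
  have a0: "a \<noteq> 0" "b \<noteq> 0" using ends by auto
  have 1: "g (u 0) - Ln (p 0) = g (u 1) - Ln (p 1)"
  proof (rule continuous_logarithms_differ_by_constant[of "{0..1::real}"])
    show "continuous_on {0..1} (\<lambda>s. Ln (p s))" using p by (intro continuous_intros) auto
    fix s :: real assume s: "s \<in> {0..1}"
    have "p s \<noteq> 0" using p(2)[OF s] by auto
    then show "exp (g (u s)) = exp (Ln (p s))" using upper[of "u s"] us[OF s] by simp
  qed (use g1 in auto)
  have 2: "g (- u 0) - (Ln (- q 0) + \<i> * pi) = g (- u 1) - (Ln (- q 1) + \<i> * pi)"
  proof (rule continuous_logarithms_differ_by_constant[of "{0..1::real}"])
    show "continuous_on {0..1} (\<lambda>s. Ln (- q s) + \<i> * pi)" using q by (intro continuous_intros) auto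
    fix s :: real assume s: "s \<in> {0..1}"
    have "q s \<noteq> 0" using q(2)[OF s] by auto
    then show "exp (g (- u s)) = exp (Ln (- q s) + \<i> * pi)"
      using lower[of "- u s"] us[OF s] by (simp add: exp_add exp_pi_i)
  qed (use g1 in auto)
  have "Ln (- a) = Ln a - \<i> * pi" "Ln (- b) = Ln b + \<i> * pi"
    using Ln_minus[of a] Ln_minus[of b] a0 ends by auto
  then have "\<i> * pi + \<i> * pi = (0::complex)"
    using 1 2 ends u01 by (simp add: algebra_simps)
  then show False by (simp add: complex_eq_iff)
qed

text \<open>
  The quotient of the two maps stays at distance less than \<open>1\<close> from \<open>1\<close>, where \<open>Ln\<close> is continuous. So winding
  numbers do not change under small perturbations.
\<close>

lemma has_logarithm_on_cong_close:
  assumes F: "continuous_on S F" and f: "continuous_on S f"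
    and G: "has_logarithm_on S F" and close: "\<And>z. z \<in> S \<Longrightarrow> norm (F z - f z) < norm (f z)"
  shows "has_logarithm_on S f"
proof -
  obtain g where g: "continuous_on S g" "\<And>z. z \<in> S \<Longrightarrow> F z = exp (g z)"
    using G unfolding has_logarithm_on_def by blast
  have f0: "f z \<noteq> 0" if "z \<in> S" for z using close[OF that] by auto
  have re: "F z / f z \<notin> \<real>\<^sub>\<le>\<^sub>0" if z: "z \<in> S" for z
  proof
    assume "F z / f z \<in> \<real>\<^sub>\<le>\<^sub>0"
    then have "1 \<le> \<bar>Re (F z / f z - 1)\<bar>" by (auto simp: complex_nonpos_Reals_iff)
    also have "\<dots> \<le> norm (F z / f z - 1)" by (rule abs_Re_le_cmod)
    also have "F z / f z - 1 = (F z - f z) / f z" using f0[OF z] by (simp add: field_simps)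
    also have "norm \<dots> < 1" using close[OF z] f0[OF z] by (simp add: norm_divide)
    finally show False by simp
  qed
  have "continuous_on S (\<lambda>z. g z - Ln (F z / f z))"
    using re f0 by (intro continuous_intros g(1) F f) auto
  moreover have "f z = exp (g z - Ln (F z / f z))" if "z \<in> S" for z
    using re[OF that] f0[OF that] g(2)[OF that] by (auto simp: exp_diff)
  ultimately show ?thesis unfolding has_logarithm_on_def by blast
qed


section \<open>Winding around an interior point of a minimal arc\<close>

lemma arc_coordinate:
  fixes X :: "'a::metric_space set"
  assumes "arc \<gamma>" "path_image \<gamma> \<subseteq> X"
  obtains \<tau> :: "'a \<Rightarrow> real" where "continuous_on X \<tau>" "\<And>x. x \<in> X \<Longrightarrow> \<tau> x \<in> {0..1}"
    "\<And>s. s \<in> {0..1} \<Longrightarrow> \<tau> (\<gamma> s) = s"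
proof -
  obtain \<sigma> where \<sigma>: "homeomorphism {0..1} (path_image \<gamma>) \<gamma> \<sigma>"
    using homeomorphism_compact[of "{0..1}" \<gamma>] assms(1) unfolding arc_def path_def path_image_def by blast
  have "normal_space (top_of_set X)"
    by (simp add: metrizable_imp_normal_space metrizable_space_euclidean metrizable_space_subtopology)
  moreover have "closedin (top_of_set X) (path_image \<gamma>)"
    using assms by (simp add: arc_imp_path closed_subset compact_imp_closed compact_path_image)
  moreover have "continuous_map (subtopology (top_of_set X) (path_image \<gamma>)) euclideanreal \<sigma>"
    using \<sigma> assms(2) by (simp add: homeomorphism_def subtopology_subtopology inf_absorb2)
  moreover have "\<sigma> ` path_image \<gamma> \<subseteq> {0..1}" using \<sigma> by (simp add: homeomorphism_def)
  ultimately obtain \<tau> where \<tau>: "continuous_map (top_of_set X) euclideanreal \<tau>"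
    "\<And>x. x \<in> path_image \<gamma> \<Longrightarrow> \<tau> x = \<sigma> x" "\<tau> ` topspace (top_of_set X) \<subseteq> {0..1}"
    by (rule Tietze_extension_closed_real_interval) auto
  show thesis
  proof (rule that[of \<tau>])
    show "\<tau> (\<gamma> s) = s" if "s \<in> {0..1}" for s
      using \<tau>(2)[of "\<gamma> s"] \<sigma> that by (simp add: homeomorphism_def path_image_def)
  qed (use \<tau> in auto)
qed

lemma open_path_component_of_complement:
  fixes X :: "'a::metric_space set"
  assumes "locally path_connected X" "closed K"
  shows "openin (top_of_set X) (path_component_set (X - K) x)"
proof (cases "x \<in> X - K")
  case True
  have "openin (top_of_set X) (X - K)" using assms(2) by (simp add: Diff_eq open_Compl openin_open_Int)
  then show ?thesis using assms(1) True locally_path_connected_open_path_component by blast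
next
  case False
  then have "path_component_set (X - K) x = {}" using path_component_eq_empty by blast
  then show ?thesis by (simp only: openin_empty)
qed

lemma closedin_path_component_Un_complement:
  fixes X :: "'a::metric_space set"
  assumes lpc: "locally path_connected X" and K: "closed K"
  shows "closedin (top_of_set X) (X \<inter> (path_component_set (X - K) x \<union> K))"
proof -
  let ?C = "path_component_set (X - K) x"
  have "X - (?C \<union> K) = \<Union>((\<lambda>y. path_component_set (X - K) y) ` (X - K - ?C))"
  proof
    show "X - (?C \<union> K) \<subseteq> \<Union>((\<lambda>y. path_component_set (X - K) y) ` (X - K - ?C))"
      by (auto simp: path_component_refl)
    show "\<Union>((\<lambda>y. path_component_set (X - K) y) ` (X - K - ?C)) \<subseteq> X - (?C \<union> K)"
      using path_component_subset[of "X - K"] by (auto dest: path_component_sym path_component_trans)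
  qed
  then have "openin (top_of_set X) (X - (?C \<union> K))"
    using open_path_component_of_complement[OF lpc K] by (metis (no_types, lifting) imageE openin_Union)
  then have "closedin (top_of_set X) (X - (X - (?C \<union> K)))" by (intro closedin_diff) simp_all
  moreover have "X - (X - (?C \<union> K)) = X \<inter> (?C \<union> K)" by blast
  ultimately show ?thesis by simp
qed

text \<open>
  A component of the complement of \<open>K\<close> can only be left through \<open>K\<close>, so two maps that agree on \<open>K\<close> may be
  exchanged on the component. This produces the map to the plane and the retractions below.
\<close>

lemma continuous_on_glue_across:
  fixes X :: "'a::metric_space set" and f g :: "'a \<Rightarrow> 'b::topological_space"
  assumes lpc: "locally path_connected X" and K: "closed K"
    and f: "continuous_on X f" and g: "continuous_on X g"
    and fg: "\<And>z. z \<in> X \<inter> K \<Longrightarrow> f z = g z"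
  shows "continuous_on X (\<lambda>z. if z \<in> path_component_set (X - K) x then f z else g z)"
proof -
  let ?C = "path_component_set (X - K) x"
  have cl: "closedin (top_of_set X) (X \<inter> (?C \<union> K))"
    by (rule closedin_path_component_Un_complement[OF lpc K])
  have cl2: "closedin (top_of_set X) (X - ?C)"
    by (intro closedin_diff open_path_component_of_complement lpc K) simp
  have Xeq: "(X \<inter> (?C \<union> K)) \<union> (X - ?C) = X" by blast
  have "continuous_on ((X \<inter> (?C \<union> K)) \<union> (X - ?C)) (\<lambda>z. if z \<in> ?C then f z else g z)"
  proof (rule continuous_on_cases_local)
    show "closedin (top_of_set (X \<inter> (?C \<union> K) \<union> (X - ?C))) (X \<inter> (?C \<union> K))"
      unfolding Xeq by (rule cl)
    show "closedin (top_of_set (X \<inter> (?C \<union> K) \<union> (X - ?C))) (X - ?C)"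
      unfolding Xeq by (rule cl2)
    show "continuous_on (X \<inter> (?C \<union> K)) f" using f by (rule continuous_on_subset) blast
    show "continuous_on (X - ?C) g" using g by (rule continuous_on_subset) blast
    show "f z = g z" if "z \<in> X \<inter> (?C \<union> K) \<and> z \<notin> ?C \<or> z \<in> X - ?C \<and> z \<in> ?C" for z
      using that fg by blast
  qed
  then show ?thesis unfolding Xeq .
qed

text \<open>
  The imaginary part of \<open>\<phi>\<close> is the distance from the arc, with positive sign in the component of
  \<open>x\<close> and negative sign elsewhere; the real part extends the parameter of the arc, shifted by \<open>t\<close>. Thus \<open>\<phi>\<close> takes a
  real value only on the arc. The path from \<open>x\<close> to \<open>y\<close> off \<open>\<gamma> ` {0..t}\<close> avoids the
  nonpositive reals and the return path off \<open>\<gamma> ` {t..1}\<close> avoids the nonnegative reals, so the loop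
  winds once around \<open>0\<close>.
\<close>

lemma essential_loop_around_interior_point:
  fixes X :: "'a::metric_space set" and \<gamma> :: "real \<Rightarrow> 'a"
  assumes lpc: "locally path_connected X"
    and \<gamma>: "arc \<gamma>" "path_image \<gamma> \<subseteq> X"
    and sep: "\<not> path_component (X - path_image \<gamma>) x y"
    and xy: "x \<in> X - path_image \<gamma>" "y \<in> X - path_image \<gamma>"
    and t: "t \<in> {0..1}"
    and left: "path_component (X - \<gamma> ` {0..t}) x y"
    and right: "path_component (X - \<gamma> ` {t..1}) x y"
  obtains \<phi> :: "'a \<Rightarrow> complex" and \<l> :: "complex \<Rightarrow> 'a"
  where "continuous_on X \<phi>" "\<And>z. z \<in> X \<Longrightarrow> \<phi> z = 0 \<longleftrightarrow> z = \<gamma> t"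
    "continuous_on (sphere 0 1) \<l>" "\<l> ` sphere 0 1 \<subseteq> X - {\<gamma> t}"
    "\<not> has_logarithm_on (sphere 0 1) (\<lambda>z. \<phi> (\<l> z))"
proof -
  let ?K = "path_image \<gamma>"
  let ?C = "path_component_set (X - ?K) x"
  have cK: "closed ?K" "?K \<noteq> {}"
    using \<gamma>(1) by (auto simp: arc_imp_path compact_imp_closed compact_path_image)
  obtain \<tau> where \<tau>: "continuous_on X \<tau>" "\<And>s. s \<in> {0..1} \<Longrightarrow> \<tau> (\<gamma> s) = s"
    using arc_coordinate[OF \<gamma>] by metis
  define v where "v = (\<lambda>z. if z \<in> ?C then infdist z ?K else - infdist z ?K)"
  have contv: "continuous_on X v"
    unfolding v_def by (rule continuous_on_glue_across[OF lpc cK(1)])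
      (auto intro!: continuous_intros)
  define \<phi> where "\<phi> = (\<lambda>z. Complex (\<tau> z - t) (v z))"
  have cont\<phi>: "continuous_on X \<phi>"
    unfolding \<phi>_def Complex_eq by (intro continuous_intros \<tau> contv)
  have v0: "v z = 0 \<longleftrightarrow> z \<in> ?K" for z
    unfolding v_def using in_closed_iff_infdist_zero[OF cK] by auto
  have on_arc: "\<exists>s\<in>{0..1}. z = \<gamma> s \<and> \<tau> z = s" if "v z = 0" for z
    using that \<tau>(2) unfolding v0 path_image_def by blast
  have \<phi>0: "\<phi> z = 0 \<longleftrightarrow> z = \<gamma> t" if "z \<in> X" for z
  proof
    assume "\<phi> z = 0"
    then have "v z = 0" "\<tau> z = t" by (auto simp: \<phi>_def complex_eq_iff)
    then show "z = \<gamma> t" using on_arc by blast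
  next
    assume "z = \<gamma> t"
    then show "\<phi> z = 0" using \<tau>(2)[OF t] v0[of z] t by (auto simp: \<phi>_def complex_eq_iff path_image_def)
  qed
  have x: "Im (\<phi> x) > 0"
    using xy in_closed_iff_infdist_zero[OF cK, of x] infdist_nonneg[of x ?K]
    by (auto simp: \<phi>_def v_def path_component_refl less_le)
  have y: "Im (\<phi> y) < 0"
    using xy sep in_closed_iff_infdist_zero[OF cK, of y] infdist_nonneg[of y ?K]
    by (auto simp: \<phi>_def v_def less_le)
  obtain p where p: "path p" "path_image p \<subseteq> X - \<gamma> ` {0..t}" "p 0 = x" "p 1 = y"
    using left unfolding path_component_def pathstart_def pathfinish_def by blast
  obtain q where q: "path q" "path_image q \<subseteq> X - \<gamma> ` {t..1}" "q 0 = y" "q 1 = x"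
    using path_component_sym[OF right] unfolding path_component_def pathstart_def pathfinish_def by blast
  have pX: "p s \<in> X - \<gamma> ` {0..t}" "q s \<in> X - \<gamma> ` {t..1}" if "s \<in> {0..1}" for s
    using that p(2) q(2) unfolding path_image_def by blast+
  have avoid_left: "\<phi> z \<notin> \<real>\<^sub>\<le>\<^sub>0" if "z \<notin> \<gamma> ` {0..t}" for z
  proof
    assume "\<phi> z \<in> \<real>\<^sub>\<le>\<^sub>0"
    then have "v z = 0" "\<tau> z \<le> t" by (auto simp: \<phi>_def complex_nonpos_Reals_iff)
    then show False using on_arc[of z] that by auto
  qed
  have avoid_right: "- \<phi> z \<notin> \<real>\<^sub>\<le>\<^sub>0" if "z \<notin> \<gamma> ` {t..1}" for z
  proof
    assume "- \<phi> z \<in> \<real>\<^sub>\<le>\<^sub>0"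
    then have "v z = 0" "\<tau> z \<ge> t" by (auto simp: \<phi>_def complex_nonpos_Reals_iff)
    then show False using on_arc[of z] that by auto
  qed
  \<comment> \<open>The upper half circle runs along \<open>p\<close> from \<open>1\<close> to \<open>-1\<close>, the lower one along \<open>q\<close> back to \<open>1\<close>.\<close>
  define \<l> where "\<l> = (\<lambda>z. if Im z \<ge> 0 then p ((1 - Re z) / 2) else q ((1 + Re z) / 2))"
  have re: "(1 - Re z) / 2 \<in> {0..1}" "(1 + Re z) / 2 \<in> {0..1}" if "z \<in> sphere 0 1" for z
    using that abs_Re_le_cmod[of z] by auto
  have lower: "\<l> z = q ((1 + Re z) / 2)" if z: "z \<in> sphere 0 1" "Im z \<le> 0" for z
  proof (cases "Im z = 0")
    case True
    then have "\<bar>Re z\<bar> = 1" using z(1) by (simp add: cmod_eq_Re)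
    then have "Re z = 1 \<or> Re z = -1" by linarith
    then show ?thesis using True p q by (auto simp: \<l>_def)
  qed (use z in \<open>simp add: \<l>_def\<close>)
  have "continuous_on ((sphere 0 1 \<inter> {z. Im z \<ge> 0}) \<union> (sphere 0 1 \<inter> {z. Im z \<le> 0})) \<l>"
  proof (rule continuous_on_closed_Un)
    show "continuous_on (sphere 0 1 \<inter> {z. Im z \<ge> 0}) \<l>"
    proof (rule continuous_on_eq)
      show "continuous_on (sphere 0 1 \<inter> {z. Im z \<ge> 0}) (\<lambda>z. p ((1 - Re z) / 2))"
        by (rule continuous_on_compose2[of "{0..1}" p])
          (use p(1) re in \<open>auto simp: path_def intro!: continuous_intros\<close>)
    qed (simp add: \<l>_def)
    show "continuous_on (sphere 0 1 \<inter> {z. Im z \<le> 0}) \<l>"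
    proof (rule continuous_on_eq)
      show "continuous_on (sphere 0 1 \<inter> {z. Im z \<le> 0}) (\<lambda>z. q ((1 + Re z) / 2))"
        by (rule continuous_on_compose2[of "{0..1}" q])
          (use q(1) re in \<open>auto simp: path_def intro!: continuous_intros\<close>)
    qed (use lower in auto)
  qed (auto intro!: closed_Int closed_halfspace_Im_ge closed_halfspace_Im_le)
  moreover have "(sphere 0 1 \<inter> {z. Im z \<ge> 0}) \<union> (sphere 0 1 \<inter> {z. Im z \<le> 0}) = sphere (0::complex) 1"
    by auto
  ultimately have cont\<l>: "continuous_on (sphere 0 1) \<l>" by simp
  show thesis
  proof (rule that[OF cont\<phi> \<phi>0 cont\<l>])
    have "\<gamma> t \<in> \<gamma> ` {0..t}" "\<gamma> t \<in> \<gamma> ` {t..1}" using t by auto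
    then have "p s \<in> X - {\<gamma> t}" "q s \<in> X - {\<gamma> t}" if "s \<in> {0..1}" for s
      using pX[OF that] by (metis Diff_iff singletonD)+
    then show "\<l> ` sphere 0 1 \<subseteq> X - {\<gamma> t}"
      using re unfolding \<l>_def image_subset_iff by presburger
    show "\<not> has_logarithm_on (sphere 0 1) (\<lambda>z. \<phi> (\<l> z))"
    proof
      assume "has_logarithm_on (sphere 0 1) (\<lambda>z. \<phi> (\<l> z))"
      then obtain g where g: "continuous_on (sphere 0 1) g" "\<And>z. z \<in> sphere 0 1 \<Longrightarrow> \<phi> (\<l> z) = exp (g z)"
        unfolding has_logarithm_on_def by blast
      show False
      proof (rule no_logarithm_of_loop_around_zero[of "\<lambda>s. \<phi> (p s)" "\<lambda>s. \<phi> (q s)" "\<phi> x" "\<phi> y" g])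
        show "continuous_on {0..1} (\<lambda>s. \<phi> (p s))" "continuous_on {0..1} (\<lambda>s. \<phi> (q s))"
          using p(1) q(1) pX unfolding path_def by (auto intro!: continuous_on_compose2[OF cont\<phi>])
        show "\<phi> (p s) \<notin> \<real>\<^sub>\<le>\<^sub>0" "- \<phi> (q s) \<notin> \<real>\<^sub>\<le>\<^sub>0" if "s \<in> {0..1}" for s
          using pX[OF that] avoid_left avoid_right by auto
        show "exp (g z) = \<phi> (p ((1 - Re z) / 2))" if "z \<in> sphere 0 1" "Im z \<ge> 0" for z
          using g(2)[OF that(1)] that by (simp add: \<l>_def)
        show "exp (g z) = \<phi> (q ((1 + Re z) / 2))" if "z \<in> sphere 0 1" "Im z \<le> 0" for z
          using g(2)[OF that(1)] lower[OF that] by simp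
      qed (use p q x y g in auto)
    qed
  qed
qed

section \<open>Loops in a retract that touches its complement\<close>

text \<open>
  The loop bounds a disc in the retract \<open>A\<close>. For a homeomorphism \<open>h\<close> with \<open>h p \<in> W\<close> and inverse \<open>k\<close>, the
  image of that disc under \<open>k\<close> misses \<open>p\<close>, so \<open>\<phi> \<circ> k\<close> has a logarithm along the disc, in particular
  along the loop. If \<open>k\<close> is close to the identity, this passes to \<open>\<phi>\<close> itself.
\<close>

lemma logarithm_of_loop_in_retract:
  fixes X :: "'a::metric_space set" and \<phi> :: "'a \<Rightarrow> complex"
  assumes X: "compact X" "homogeneous X" "disc_simply_connected X"
    and R: "continuous_on X R" "R ` X \<subseteq> A" "A \<subseteq> X" "\<And>z. z \<in> A \<Longrightarrow> R z = z"
    and W: "openin (top_of_set X) W" "W \<inter> A = {}" "p \<in> closure W"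
    and p: "p \<in> X"
    and \<phi>: "continuous_on X \<phi>" "\<And>z. z \<in> X \<Longrightarrow> \<phi> z = 0 \<longleftrightarrow> z = p"
    and \<l>: "continuous_on (sphere 0 1) \<l>" "\<l> ` sphere (0::complex) 1 \<subseteq> A - {p}"
  shows "has_logarithm_on (sphere 0 1) (\<lambda>z. \<phi> (\<l> z))"
proof -
  have \<l>A: "\<l> z \<in> A" "\<l> z \<in> X" "\<l> z \<noteq> p" if "z \<in> sphere 0 1" for z
    using that \<l>(2) R(3) by blast+
  have cont\<phi>\<l>: "continuous_on (sphere 0 1) (\<lambda>z. \<phi> (\<l> z))"
    by (rule continuous_on_compose2[OF \<phi>(1) \<l>(1)]) (use \<l>A in auto)
  have "sphere (0::complex) 1 \<noteq> {}" by simp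
  then obtain z0 where z0: "z0 \<in> sphere 0 1" "\<And>z. z \<in> sphere 0 1 \<Longrightarrow> norm (\<phi> (\<l> z0)) \<le> norm (\<phi> (\<l> z))"
    using continuous_attains_inf[of "sphere (0::complex) 1" "\<lambda>z. norm (\<phi> (\<l> z))"]
      continuous_on_norm[OF cont\<phi>\<l>] compact_sphere by blast
  have m0: "norm (\<phi> (\<l> z0)) > 0" using \<l>A[OF z0(1)] \<phi>(2) by simp
  have "uniformly_continuous_on X \<phi>" using \<phi>(1) X(1) by (rule compact_uniformly_continuous)
  then obtain d where d: "d > 0" "\<And>a b. a \<in> X \<Longrightarrow> b \<in> X \<Longrightarrow> dist a b < d \<Longrightarrow> dist (\<phi> a) (\<phi> b) < norm (\<phi> (\<l> z0))"
    using m0 unfolding uniformly_continuous_on_def by blast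
  obtain h k where hk: "homeomorphism X X h k" "h p \<in> W" "\<And>x. x \<in> X \<Longrightarrow> dist (k x) x < d"
    using approximate_homogeneity[OF X(1) _ p d(1) W(1,3)] X(2) unfolding homogeneous_def by metis
  have kX: "k x \<in> X" "h (k x) = x" if "x \<in> X" for x using hk(1) that by (auto simp: homeomorphism_def)
  have contk: "continuous_on X k" using hk(1) by (simp add: homeomorphism_def)
  have "\<l> ` sphere 0 1 \<subseteq> X" using \<l>A by blast
  then obtain f where f: "continuous_on (cball 0 1) f" "f ` cball (0::complex) 1 \<subseteq> X" "\<And>z. z \<in> sphere 0 1 \<Longrightarrow> f z = \<l> z"
    using X(3) \<l>(1) unfolding disc_simply_connected_def by metis
  have RfA: "R (f z) \<in> A" "R (f z) \<in> X" if "z \<in> cball 0 1" for z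
    using that f(2) R(2,3) by blast+
  have contRf: "continuous_on (cball 0 1) (\<lambda>z. R (f z))"
    by (rule continuous_on_compose2[OF R(1) f(1) f(2)])
  have contkRf: "continuous_on (cball 0 1) (\<lambda>z. k (R (f z)))"
    by (rule continuous_on_compose2[OF contk contRf]) (use RfA in auto)
  have cont: "continuous_on (cball 0 1) (\<lambda>z. \<phi> (k (R (f z))))"
    by (rule continuous_on_compose2[OF \<phi>(1) contkRf]) (use RfA kX in auto)
  have "\<phi> (k (R (f z))) \<noteq> 0" if z: "z \<in> cball 0 1" for z
  proof
    assume "\<phi> (k (R (f z))) = 0"
    then have "k (R (f z)) = p" using \<phi>(2) kX RfA[OF z] by blast
    then have "R (f z) = h p" using kX RfA[OF z] by metis
    then show False using hk(2) W(2) RfA[OF z] by auto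
  qed
  then obtain g where g: "continuous_on (cball 0 1) g" "\<And>z. z \<in> cball 0 1 \<Longrightarrow> \<phi> (k (R (f z))) = exp (g z)"
    using continuous_logarithm_on_cball[OF cont] by blast
  have Rf\<l>: "R (f z) = \<l> z" if "z \<in> sphere 0 1" for z
    using f(3)[OF that] R(4) \<l>A[OF that] by simp
  have "sphere (0::complex) 1 \<subseteq> cball 0 1" by auto
  then have "has_logarithm_on (sphere 0 1) (\<lambda>z. \<phi> (k (R (f z))))"
    using g continuous_on_subset unfolding has_logarithm_on_def by blast
  then show ?thesis
  proof (rule has_logarithm_on_cong_close[rotated 2])
    show "continuous_on (sphere 0 1) (\<lambda>z. \<phi> (k (R (f z))))"
      using cont by (rule continuous_on_subset) auto
    show "norm (\<phi> (k (R (f z))) - \<phi> (\<l> z)) < norm (\<phi> (\<l> z))" if z: "z \<in> sphere 0 1" for z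
    proof -
      have "dist (\<phi> (k (\<l> z))) (\<phi> (\<l> z)) < norm (\<phi> (\<l> z0))"
        using \<l>A[OF z] kX hk(3) by (intro d(2)) auto
      then show ?thesis using z0(2)[OF z] Rf\<l>[OF z] by (simp add: dist_norm)
    qed
  qed (rule cont\<phi>\<l>)
qed


section \<open>The endpoint of a minimal arc\<close>

text \<open>
  A path from \<open>x\<close> to \<open>y\<close> that avoids all but a short initial piece of \<open>\<gamma>\<close> has to leave the component of
  \<open>x\<close> through that piece.
\<close>

lemma arc_start_in_closure_of_component:
  fixes X :: "'a::metric_space set" and \<gamma> :: "real \<Rightarrow> 'a"
  assumes lpc: "locally path_connected X"
    and \<gamma>: "path \<gamma>" "path_image \<gamma> \<subseteq> X"
    and sep: "\<not> path_component (X - path_image \<gamma>) x y"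
    and xy: "x \<in> X - path_image \<gamma>"
    and right: "\<And>s. 0 < s \<Longrightarrow> s \<le> 1 \<Longrightarrow> path_component (X - \<gamma> ` {s..1}) x y"
  shows "\<gamma> 0 \<in> closure (path_component_set (X - path_image \<gamma>) x)"
proof (rule ccontr)
  let ?K = "path_image \<gamma>"
  let ?C = "path_component_set (X - ?K) x"
  assume n: "\<gamma> 0 \<notin> closure ?C"
  have cK: "closed ?K" using \<gamma>(1) by (simp add: compact_imp_closed compact_path_image)
  have op: "openin (top_of_set {0..1}) ({0..1} \<inter> \<gamma> -` (- closure ?C))"
    using \<gamma>(1) unfolding path_def by (intro continuous_openin_preimage_gen) auto
  have "0 \<in> {0..1} \<inter> \<gamma> -` (- closure ?C)" using n by simp
  then obtain d where d: "d > 0" "ball 0 d \<inter> {0..1} \<subseteq> {0..1} \<inter> \<gamma> -` (- closure ?C)"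
    using op[unfolded openin_contains_ball] by blast
  define s where "s = min (d/2) 1"
  have s: "0 < s" "s \<le> 1" "s < d" using d(1) unfolding s_def by auto
  obtain p where p: "path p" "path_image p \<subseteq> X - \<gamma> ` {s..1}" "pathstart p = x" "pathfinish p = y"
    using right[OF s(1,2)] unfolding path_component_def by blast
  have K: "\<gamma> ` {0..1} \<subseteq> \<gamma> ` {s..1} \<union> - closure ?C"
  proof
    fix z assume "z \<in> \<gamma> ` {0..1}"
    then obtain t where t: "t \<in> {0..1}" "z = \<gamma> t" by blast
    show "z \<in> \<gamma> ` {s..1} \<union> - closure ?C"
    proof (cases "s \<le> t")
      case False
      then have "t \<in> ball 0 d \<inter> {0..1}" using t s by auto
      then show ?thesis using d(2) t by blast
    qed (use t in auto)
  qed
  have "X \<inter> closure ?C \<subseteq> ?C \<union> ?K"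
  proof -
    obtain T where T: "closed T" "X \<inter> (?C \<union> ?K) = X \<inter> T"
      using closedin_path_component_Un_complement[OF lpc cK, of x] by (auto simp: closedin_closed)
    have "?C \<subseteq> X" using path_component_subset[of "X - ?K" x] by blast
    then have "?C \<subseteq> T" using T(2) by blast
    then have "closure ?C \<subseteq> T" using T(1) by (simp add: closure_minimal)
    then show ?thesis using T(2) by blast
  qed
  then have cl: "path_image p \<inter> closure ?C = path_image p \<inter> ?C"
    using p(2) K closure_subset[of ?C] unfolding path_image_def[of \<gamma>] by blast
  have xC: "x \<in> path_image p \<inter> ?C" using p(1,3) xy pathstart_in_path_image[of p]
    by (auto simp: path_component_refl)
  have "openin (top_of_set (path_image p)) (path_image p \<inter> ?C)"
  proof -
    obtain T where "open T" "?C = X \<inter> T"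
      using open_path_component_of_complement[OF lpc cK, of x] by (auto simp: openin_open)
    then have "path_image p \<inter> ?C = path_image p \<inter> T" using p(2) by blast
    then show ?thesis using \<open>open T\<close> by (simp add: openin_open_Int)
  qed
  moreover have "closedin (top_of_set (path_image p)) (path_image p \<inter> ?C)"
    unfolding cl[symmetric] by (simp add: closedin_closed_Int)
  moreover have "connected (path_image p)" using p(1) by (rule connected_path_image)
  ultimately have "path_image p \<inter> ?C = path_image p" using xC unfolding connected_clopen by blast
  then have "y \<in> ?C" using p(4) pathfinish_in_path_image[of p] by blast
  then show False using sep by simp
qed

text \<open>
  This is the heart of the proof: the midpoint of the arc provides a loop winding around the
  endpoint \<open>p\<close>, and the two sides of the arc provide retracts to which \<open>p\<close> is exposed.
\<close>

lemma minimal_arc_does_not_separate: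
  fixes X :: "'a::metric_space set" and \<gamma> :: "real \<Rightarrow> 'a"
  assumes X: "compact X" "locally path_connected X" "homogeneous X" "disc_simply_connected X"
    and \<gamma>: "arc \<gamma>" "path_image \<gamma> \<subseteq> X"
    and xy: "x \<in> X - path_image \<gamma>" "y \<in> X - path_image \<gamma>"
    and left: "\<And>s. 0 \<le> s \<Longrightarrow> s < 1 \<Longrightarrow> path_component (X - \<gamma> ` {0..s}) x y"
    and right: "\<And>s. 0 < s \<Longrightarrow> s \<le> 1 \<Longrightarrow> path_component (X - \<gamma> ` {s..1}) x y"
  shows "path_component (X - path_image \<gamma>) x y"
proof (rule ccontr)
  assume sep: "\<not> path_component (X - path_image \<gamma>) x y"
  let ?K = "path_image \<gamma>"
  let ?C = "path_component_set (X - ?K) x"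
  let ?D = "path_component_set (X - ?K) y"
  define p where "p = \<gamma> 0"
  have K: "closed ?K" "?K \<noteq> {}" using \<gamma>(1) by (auto simp: arc_imp_path compact_imp_closed compact_path_image)
  have pK: "p \<in> ?K" and pX: "p \<in> X" using \<gamma>(2) unfolding p_def path_image_def by auto
  have CX: "?C \<subseteq> X - ?K" "?D \<subseteq> X - ?K" by (rule path_component_subset)+
  have CD: "?C \<inter> ?D = {}" using sep by (auto dest: path_component_sym path_component_trans)

  have "\<gamma> (1/2) \<in> X" using \<gamma>(2) unfolding path_image_def by auto
  then obtain h k where hk: "homeomorphism X X h k" "h (\<gamma> (1/2)) = p"
    using X(3) pX unfolding homogeneous_def by blast
  have half: "(1/2::real) \<in> {0..1}" by simp
  have lr: "path_component (X - \<gamma> ` {0..1/2}) x y" "path_component (X - \<gamma> ` {1/2..1}) x y"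
    by (rule left, simp_all) (rule right, simp_all)
  obtain \<phi>' \<l>' where \<phi>': "continuous_on X \<phi>'" "\<And>z. z \<in> X \<Longrightarrow> \<phi>' z = (0::complex) \<longleftrightarrow> z = \<gamma> (1/2)"
    and \<l>': "continuous_on (sphere (0::complex) 1) \<l>'" "\<l>' ` sphere 0 1 \<subseteq> X - {\<gamma> (1/2)}"
    and nolog': "\<not> has_logarithm_on (sphere 0 1) (\<lambda>z. \<phi>' (\<l>' z))"
    by (rule essential_loop_around_interior_point[OF X(2) \<gamma> sep xy half lr]) (rule that)
  \<comment> \<open>transport of the map and the loop from the midpoint to the endpoint \<open>p\<close>\<close>
  define \<phi> where "\<phi> = (\<lambda>z. \<phi>' (k z))"
  define \<l> where "\<l> = (\<lambda>z. h (\<l>' z))"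
  have hkX: "h z \<in> X" "k z \<in> X" "k (h z) = z" "h (k z) = z" if "z \<in> X" for z
    using hk(1) that by (auto simp: homeomorphism_def)
  have hkc: "continuous_on X h" "continuous_on X k" using hk(1) by (auto simp: homeomorphism_def)
  have \<phi>: "continuous_on X \<phi>" unfolding \<phi>_def
    by (rule continuous_on_compose2[OF \<phi>'(1) hkc(2)]) (use hkX in auto)
  have hk_iff: "k z = \<gamma> (1/2) \<longleftrightarrow> z = p" if "z \<in> X" for z
    using hkX(4)[OF that] hkX(3)[OF \<open>\<gamma> (1/2) \<in> X\<close>] hk(2) by auto
  have \<phi>0: "\<phi> z = 0 \<longleftrightarrow> z = p" if "z \<in> X" for z
    unfolding \<phi>_def by (simp add: \<phi>'(2) hkX that hk_iff)
  have \<l>: "continuous_on (sphere 0 1) \<l>" unfolding \<l>_def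
    by (rule continuous_on_compose2[OF hkc(1) \<l>'(1)]) (use \<l>'(2) in blast)
  have \<l>X: "\<l> z \<in> X" "\<l> z \<noteq> p" if "z \<in> sphere 0 1" for z
  proof -
    have z: "\<l>' z \<in> X" "\<l>' z \<noteq> \<gamma> (1/2)" using that \<l>'(2) by blast+
    then show "\<l> z \<in> X" unfolding \<l>_def by (simp add: hkX)
    show "\<l> z \<noteq> p" unfolding \<l>_def using hk_iff[of "h (\<l>' z)"] hkX z by simp
  qed
  have "\<phi> (\<l> z) = \<phi>' (\<l>' z)" if "z \<in> sphere 0 1" for z
  proof -
    have "\<l>' z \<in> X" using that \<l>'(2) by blast
    then show ?thesis unfolding \<phi>_def \<l>_def by (simp add: hkX)
  qed
  then have nolog: "\<not> has_logarithm_on (sphere 0 1) (\<lambda>z. \<phi> (\<l> z))"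
    using nolog' unfolding has_logarithm_on_def by simp

  obtain \<tau>0 :: "'a \<Rightarrow> real" where \<tau>0: "continuous_on X \<tau>0" "\<And>x. x \<in> X \<Longrightarrow> \<tau>0 x \<in> {0..1}"
    "\<And>s. s \<in> {0..1} \<Longrightarrow> \<tau>0 (\<gamma> s) = s"
    using arc_coordinate[OF \<gamma>] by blast
  \<comment> \<open>Adding the distance from the arc makes \<open>p\<close> the only zero, so that retractions built from \<open>\<tau>\<close> keep loops off \<open>p\<close>.\<close>
  define \<tau> where "\<tau> = (\<lambda>z. min 1 (\<tau>0 z + infdist z ?K))"
  have \<tau>: "continuous_on X \<tau>" unfolding \<tau>_def by (intro continuous_intros \<tau>0)
  have \<tau>01: "\<tau> z \<in> {0..1}" if "z \<in> X" for z
    using \<tau>0(2)[OF that] infdist_nonneg[of z ?K] unfolding \<tau>_def by auto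
  have \<tau>\<gamma>: "\<tau> (\<gamma> s) = s" if "s \<in> {0..1}" for s
    using \<tau>0(3)[OF that] that in_closed_iff_infdist_zero[OF K, of "\<gamma> s"]
    unfolding \<tau>_def path_image_def by auto
  have \<tau>pos: "\<tau> z > 0" if z: "z \<in> X" "z \<noteq> p" for z
  proof (cases "z \<in> ?K")
    case True
    then obtain s where s: "s \<in> {0..1}" "z = \<gamma> s" unfolding path_image_def by blast
    then have "s \<noteq> 0" using z(2) p_def by auto
    then show ?thesis using \<tau>\<gamma>[OF s(1)] s by auto
  next
    case False
    then have "infdist z ?K > 0" using in_closed_iff_infdist_zero[OF K, of z] infdist_nonneg[of z ?K] by linarith
    then show ?thesis using \<tau>0(2)[OF z(1)] unfolding \<tau>_def by auto
  qed
  \<comment> \<open>a retraction of \<open>X\<close> onto the arc; applied on one side of the arc only, it gives the retractions \<open>R\<close> and \<open>R'\<close>\<close>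
  define S where "S = (\<lambda>z. \<gamma> (\<tau> z))"
  have contS: "continuous_on X S" unfolding S_def
    by (rule continuous_on_compose2[of "{0..1}" \<gamma>])
      (use \<gamma>(1) \<tau> \<tau>01 in \<open>auto simp: arc_def path_def\<close>)
  have SK: "S z \<in> ?K" if "z \<in> X" for z using \<tau>01[OF that] unfolding S_def path_image_def by blast
  have Sid: "S z = z" if "z \<in> ?K" for z using that \<tau>\<gamma> unfolding S_def path_image_def by auto
  have Sp: "S z \<noteq> p" if "z \<in> X" "z \<noteq> p" for z
  proof -
    have "inj_on \<gamma> {0..1}" using \<gamma>(1) by (simp add: arc_def)
    then show ?thesis
      using \<tau>pos[OF that] \<tau>01[OF that(1)] inj_onD[of \<gamma> "{0..1}" "\<tau> z" 0] unfolding S_def p_def by auto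
  qed

  define R where "R = (\<lambda>z. if z \<in> ?C then S z else z)"
  define R' where "R' = (\<lambda>z. if z \<in> ?C then z else S z)"
  have contR: "continuous_on X R" "continuous_on X R'" unfolding R_def R'_def
    by (rule continuous_on_glue_across[OF X(2) K(1)]; simp add: contS Sid continuous_on_id)+
  have contl: "continuous_on (sphere 0 1) (\<lambda>z. R (\<l> z))" "continuous_on (sphere 0 1) (\<lambda>z. R' (\<l> z))"
    using \<l>X(1) by (blast intro: continuous_on_compose2[OF contR(1) \<l>] continuous_on_compose2[OF contR(2) \<l>])+
  have SC: "S z \<in> X - ?C" if "z \<in> X" for z using SK[OF that] CX(1) \<gamma>(2) by blast
  have RX: "R z \<in> X - ?C" if "z \<in> X" for z
    using SC[OF that] that by (simp add: R_def)
  have Rp: "R z \<noteq> p" if "z \<in> X" "z \<noteq> p" for z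
    using Sp[OF that] that by (simp add: R_def)
  have R'X: "R' z \<in> ?C \<union> ?K" if "z \<in> X" for z
    using SK[OF that] by (simp add: R'_def)
  have R'p: "R' z \<noteq> p" if "z \<in> X" "z \<noteq> p" for z
    using Sp[OF that] that by (simp add: R'_def)
  have "has_logarithm_on (sphere 0 1) (\<lambda>z. \<phi> (R (\<l> z)))"
  proof (rule logarithm_of_loop_in_retract[OF X(1,3,4) contR(1), of "X - ?C" ?C p])
    show "R ` X \<subseteq> X - ?C" using RX by blast
    show "(\<lambda>z. R (\<l> z)) ` sphere 0 1 \<subseteq> X - ?C - {p}" using RX Rp \<l>X by blast
    show "openin (top_of_set X) ?C" by (rule open_path_component_of_complement[OF X(2) K(1)])
    show "p \<in> closure ?C" unfolding p_def
      by (rule arc_start_in_closure_of_component[OF X(2) arc_imp_path[OF \<gamma>(1)] \<gamma>(2) sep xy(1) right])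
  qed (use contl pX \<phi> \<phi>0 in \<open>auto simp: R_def\<close>)
  moreover have "has_logarithm_on (sphere 0 1) (\<lambda>z. \<phi> (R' (\<l> z)))"
  proof (rule logarithm_of_loop_in_retract[OF X(1,3,4) contR(2), of "?C \<union> ?K" ?D p])
    show "R' ` X \<subseteq> ?C \<union> ?K" using R'X by blast
    show "?C \<union> ?K \<subseteq> X" using CX \<gamma>(2) by blast
    show "R' z = z" if "z \<in> ?C \<union> ?K" for z using that Sid unfolding R'_def by (metis Un_iff)
    show "?D \<inter> (?C \<union> ?K) = {}" using CD CX(2) by blast
    show "(\<lambda>z. R' (\<l> z)) ` sphere 0 1 \<subseteq> ?C \<union> ?K - {p}" using R'X R'p \<l>X by blast
    show "openin (top_of_set X) ?D" by (rule open_path_component_of_complement[OF X(2) K(1)])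
    show "p \<in> closure ?D" unfolding p_def
    proof (rule arc_start_in_closure_of_component[OF X(2) arc_imp_path[OF \<gamma>(1)] \<gamma>(2) _ xy(2)])
      show "\<not> path_component (X - ?K) y x" using sep path_component_sym by blast
      show "path_component (X - \<gamma> ` {s..1}) y x" if "0 < s" "s \<le> 1" for s
        using right[OF that] by (rule path_component_sym)
    qed
  qed (use contl pX \<phi> \<phi>0 in auto)
  ultimately obtain g g' where
    g: "continuous_on (sphere 0 1) g" "\<And>z. z \<in> sphere 0 1 \<Longrightarrow> \<phi> (R (\<l> z)) = exp (g z)" and
    g': "continuous_on (sphere 0 1) g'" "\<And>z. z \<in> sphere 0 1 \<Longrightarrow> \<phi> (R' (\<l> z)) = exp (g' z)"
    unfolding has_logarithm_on_def by blast
  have \<gamma>X: "\<gamma> s \<in> X" "\<gamma> s \<noteq> p" if "s \<in> {0<..1}" for s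
  proof -
    show "\<gamma> s \<in> X" using that \<gamma>(2) unfolding path_image_def by auto
    have "\<tau> (\<gamma> s) = s" "\<tau> (\<gamma> 0) = 0" using that by (auto intro!: \<tau>\<gamma>)
    then show "\<gamma> s \<noteq> p" using that unfolding p_def by auto
  qed
  \<comment> \<open>\<open>S\<close> maps the loop into the half-open arc, which is contractible, so \<open>\<phi>\<close> has a logarithm there.\<close>
  have "continuous_on {0<..1} (\<lambda>s. \<phi> (\<gamma> s))"
  proof (rule continuous_on_compose2[OF \<phi>])
    show "continuous_on {0<..1} \<gamma>"
      using \<gamma>(1) unfolding arc_def path_def by (auto intro: continuous_on_subset)
  qed (use \<gamma>X in auto)
  moreover have "contractible {0<..1::real}" by (simp add: convex_imp_contractible)
  moreover have "\<phi> (\<gamma> s) \<noteq> 0" if "s \<in> {0<..1}" for s using \<phi>0 \<gamma>X[OF that] by simp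
  ultimately obtain L where L: "continuous_on {0<..1} L" "\<And>s. s \<in> {0<..1} \<Longrightarrow> \<phi> (\<gamma> s) = exp (L s)"
    using continuous_logarithm_on_contractible by metis
  have \<tau>\<l>: "\<tau> (\<l> z) \<in> {0<..1}" if "z \<in> sphere 0 1" for z
    using \<tau>pos[OF \<l>X[OF that]] \<tau>01[OF \<l>X(1)[OF that]] by simp
  have cont\<tau>\<l>: "continuous_on (sphere 0 1) (\<lambda>z. \<tau> (\<l> z))"
    by (rule continuous_on_compose2[OF \<tau> \<l>]) (use \<l>X in auto)
  have "continuous_on (sphere 0 1) (\<lambda>z. L (\<tau> (\<l> z)))"
    by (rule continuous_on_compose2[OF L(1) cont\<tau>\<l>]) (use \<tau>\<l> in blast)
  then have "continuous_on (sphere 0 1) (\<lambda>z. g z + g' z - L (\<tau> (\<l> z)))"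
    by (intro continuous_intros g(1) g'(1))
  moreover have "\<phi> (\<l> z) = exp (g z + g' z - L (\<tau> (\<l> z)))" if z: "z \<in> sphere 0 1" for z
  proof -
    have S: "\<phi> (S (\<l> z)) = exp (L (\<tau> (\<l> z)))" unfolding S_def using L(2)[OF \<tau>\<l>[OF z]] .
    \<comment> \<open>Mayer-Vietoris in multiplicative form: on either side one of \<open>R\<close>, \<open>R'\<close> is the identity and the other one is \<open>S\<close>.\<close>
    have "\<phi> (R (\<l> z)) * \<phi> (R' (\<l> z)) = \<phi> (\<l> z) * \<phi> (S (\<l> z))"
      unfolding R_def R'_def by simp
    then have "exp (g z) * exp (g' z) = \<phi> (\<l> z) * exp (L (\<tau> (\<l> z)))"
      using g(2)[OF z] g'(2)[OF z] S by simp
    then show ?thesis by (simp add: exp_add exp_diff field_simps)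
  qed
  ultimately have "has_logarithm_on (sphere 0 1) (\<lambda>z. \<phi> (\<l> z))" unfolding has_logarithm_on_def by blast
  then show False using nolog by simp
qed


section \<open>Arcs do not separate\<close>

theorem theorem1:
  fixes X :: "'a::metric_space set" and \<alpha> :: "real \<Rightarrow> 'a"
  assumes "continuum X"
    and "locally connected X"
    and "disc_simply_connected X"
    and "homogeneous X"
    and "arc \<alpha>" and "path_image \<alpha> \<subseteq> X"
  shows "\<not> separates (path_image \<alpha>) X"
proof
  assume "separates (path_image \<alpha>) X"
  then obtain C D where CD: "C \<in> components (X - path_image \<alpha>)" "D \<in> components (X - path_image \<alpha>)" "C \<noteq> D"
    unfolding separates_def by blast
  then obtain x y where x: "x \<in> X - path_image \<alpha>" "C = connected_component_set (X - path_image \<alpha>) x"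
    and y: "y \<in> X - path_image \<alpha>" "D = connected_component_set (X - path_image \<alpha>) y"
    unfolding components_def by blast
  have sep: "\<not> path_component (X - path_image \<alpha>) x y"
    using CD(3) x y by (metis connected_component_eq mem_Collect_eq path_component_subset_connected_component subsetD)
  have X: "compact X" "connected X" using assms(1) by (auto simp: continuum_def)
  have lpc: "locally path_connected X"
    by (rule compact_locally_connected_imp_locally_path_connected[OF X(1) assms(2)])
  obtain c where c: "c \<in> X" "connected (X - {c})"
    using exists_non_cut_point[OF X _ assms(2)] x by blast
  have "path_component (X - {q}) x y" if q: "q \<in> path_image \<alpha>" for q
  proof -
    have qX: "q \<in> X" "x \<noteq> q" "y \<noteq> q" using q x y assms(6) by auto
    then obtain h k where hk: "homeomorphism X X h k" "h c = q"
      using assms(4) c unfolding homogeneous_def by blast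
    have "h ` (X - {c}) = X - {q}"
      using hk c by (auto simp: homeomorphism_def) (metis (no_types) Diff_iff image_iff singletonD)+
    moreover have "connected (h ` (X - {c}))"
      using hk(1) by (intro connected_continuous_image c) (auto simp: homeomorphism_def intro: continuous_on_subset)
    ultimately have "connected (X - {q})" by simp
    moreover have "openin (top_of_set X) (X - {q})" by (simp add: openin_delete)
    then have "locally path_connected (X - {q})" using lpc locally_open_subset by blast
    ultimately show ?thesis
      using path_component_eq_connected_component[of "X - {q}" x] x y qX
      by (auto simp: connected_iff_connected_component)
  qed
  then obtain \<gamma> where "arc \<gamma>" "path_image \<gamma> \<subseteq> path_image \<alpha>"
    and \<gamma>: "\<not> path_component (X - path_image \<gamma>) x y"
    "\<And>s. 0 \<le> s \<Longrightarrow> s < 1 \<Longrightarrow> path_component (X - \<gamma> ` {0..s}) x y"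
    "\<And>s. 0 < s \<Longrightarrow> s \<le> 1 \<Longrightarrow> path_component (X - \<gamma> ` {s..1}) x y"
    using minimal_separating_subarc[OF assms(5) _ sep] by metis
  then show False
    using minimal_arc_does_not_separate[OF X(1) lpc assms(4,3), of \<gamma> x y] x y assms(6) by blast
qed

end
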